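(* For every real $C>\frac{5}{2}\sqrt{35}$ there exists $N_C$ such that whenever $n\geq N_C$ and $k$ is an integer with $k\geq C\sqrt{n\log n}$, we have $f_k(n)=kn$.
   Context: For positive integers $n,k$, $f_k(n)$ denotes the maximum size of a set of points chosen from the $n\times n$ grid $\{1,\dots,n\}\times\{1,\dots,n\}\subseteq\mathbb{Z}^2$ such that at most $k$ of the chosen points lie on any line of the Euclidean plane. Here $\log$ is the natural logarithm.
   Formalization: The formal theorem adds the hypothesis k ≤ n, since for k > n the claim fails: the grid has only n² < kn points, so f_k(n) = kn is impossible. *)

theory Defs
  imports "HOL-Analysis.Analysis"
begin

definition grid :: "nat \<Rightarrow> (real \<times> real) set" where
  "grid n = {(real i, real j) | i j. i \<in> {1..n} \<and> j \<in> {1..n}}"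

definition is_line :: "(real \<times> real) set \<Rightarrow> bool" where
  "is_line L \<longleftrightarrow> affine L \<and> aff_dim L = 1"

definition at_most_on_lines :: "nat \<Rightarrow> (real \<times> real) set \<Rightarrow> bool" where
  "at_most_on_lines k S \<longleftrightarrow> (\<forall>L. is_line L \<longrightarrow> card (S \<inter> L) \<le> k)"

definition max_points :: "nat \<Rightarrow> nat \<Rightarrow> nat" where
  "max_points k n = Max {card S | S. S \<subseteq> grid n \<and> at_most_on_lines k S}"

lemma finite_grid: "finite (grid n)"
proof -
  have "grid n = (\<lambda>(i, j). (real i, real j)) ` ({1..n} \<times> {1..n})"
    by (auto simp: grid_def)
  then show ?thesis by simp
qed

text \<open>The maximum is taken over a finite nonempty set, and every set counted by
  \<open>card\<close> is finite.\<close>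

lemma max_points_wf:
  "finite {card S | S. S \<subseteq> grid n \<and> at_most_on_lines k S}"
  "{card S | S. S \<subseteq> grid n \<and> at_most_on_lines k S} \<noteq> {}"
proof -
  have "{card S | S. S \<subseteq> grid n \<and> at_most_on_lines k S} \<subseteq> card ` Pow (grid n)"
    by auto
  then show "finite {card S | S. S \<subseteq> grid n \<and> at_most_on_lines k S}"
    using finite_grid finite_subset by blast
  have "at_most_on_lines k {}" by (simp add: at_most_on_lines_def)
  then show "{card S | S. S \<subseteq> grid n \<and> at_most_on_lines k S} \<noteq> {}" by blast
qed

end

theory Submission
  imports Defs
begin

text \<open>The set is explicit in both ranges of \<open>k\<close>.

For \<open>3k > 2n\<close> remove from the grid a set with \<open>d = n - k\<close> points in every row and column. Lines
of slope other than \<open>0, \<infinity>, \<plusminus>1\<close> meet the grid in at most \<open>(n + 1) / 2 \<le> k\<close> points; for the diagonals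
it suffices that the removed set contains two full \<open>d \<times> d\<close> squares, one on each main diagonal.

For \<open>k \<le> 2n/3\<close> take \<open>q\<close> about \<open>sqrt n\<close> and a grid of side \<open>3h\<close> with \<open>h = q m\<close>, cut into nine
\<open>h \<times> h\<close> blocks. In every row of a block a cyclic interval of columns is chosen; its start runs
through the multiples of \<open>q\<close> while the row runs through a group of \<open>m\<close> consecutive rows, and is
shifted by one in the next group. Within a group, a line \<open>(x0 + t u, y0 + t v)\<close> advances by
\<open>q u - v\<close> relative to the intervals, hence it meets its proportional share of points, up to an error
of lower order in total because \<open>k\<close> is large compared to \<open>sqrt n\<close>. This leaves ample room except for
slopes \<open>\<plusminus>1\<close>, where uniform density would give the main diagonals about \<open>k\<close> points. The interval
lengths therefore vary with the block so that every diagonal gets density at most \<open>4k/5\<close>. The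
missing \<open>n - 3h\<close> rows and columns are added one at a time by rerouting a matching, which adds at
most two points to each line.\<close>

subsection \<open>Regular sets and adding a row and a column\<close>

text \<open>Coordinates start at \<open>0\<close> here, at \<open>1\<close> in \<^const>\<open>grid\<close>.\<close>

definition regular_spread :: "nat \<Rightarrow> nat \<Rightarrow> nat \<Rightarrow> (int \<times> int) set \<Rightarrow> bool" where
  "regular_spread n k c S \<longleftrightarrow>
     S \<subseteq> {0..<int n} \<times> {0..<int n} \<and>
     (\<forall>x\<in>{0..<int n}. card {y. (x, y) \<in> S} = k) \<and>
     (\<forall>y\<in>{0..<int n}. card {x. (x, y) \<in> S} = k) \<and>
     (\<forall>x0 y0 u v. u > 0 \<longrightarrow> v \<noteq> 0 \<longrightarrow> card {t. (x0 + t * u, y0 + t * v) \<in> S} \<le> c)"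

lemma regular_spreadD:
  assumes "regular_spread n k c S"
  shows "S \<subseteq> {0..<int n} \<times> {0..<int n}"
    and "\<And>x. x \<in> {0..<int n} \<Longrightarrow> card {y. (x, y) \<in> S} = k"
    and "\<And>y. y \<in> {0..<int n} \<Longrightarrow> card {x. (x, y) \<in> S} = k"
    and "\<And>x0 y0 u v. u > 0 \<Longrightarrow> v \<noteq> 0 \<Longrightarrow> card {t. (x0 + t * u, y0 + t * v) \<in> S} \<le> c"
  using assms by (simp_all add: regular_spread_def)

lemma finite_line_params:
  fixes S :: "(int \<times> int) set"
  assumes "finite S" "u \<noteq> 0"
  shows "finite {t. (x0 + t * u, y0 + t * v) \<in> S}"
proof -
  have "inj (\<lambda>t. (x0 + t * u, y0 + t * v))"
    using assms(2) by (auto simp: inj_def)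
  from finite_vimageI[OF assms(1) this] show ?thesis by (simp add: vimage_def)
qed

text \<open>Hall's condition holds trivially, so a greedy choice works: when an index is added,
  fewer values are taken than its own set contains. This supplies the matching that is rerouted when
  a row and a column are added.\<close>

lemma ex_distinct_representatives:
  assumes "finite I" "\<And>i. i \<in> I \<Longrightarrow> card I \<le> card (F i)"
  shows "\<exists>f. inj_on f I \<and> (\<forall>i\<in>I. f i \<in> F i)"
  using assms
proof (induction I rule: finite_induct)
  case empty
  then show ?case by simp
next
  case (insert j I)
  then obtain f where f: "inj_on f I" "\<forall>i\<in>I. f i \<in> F i"
    by (metis card_insert_le insert_iff le_trans)
  have "card (f ` I) < card (F j)"
    using insert card_image[OF f(1)] by (metis card_insert_disjoint insertI1 less_eq_Suc_le)
  then obtain z where z: "z \<in> F j" "z \<notin> f ` I"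
    by (metis card_mono finite_imageI insert.hyps(1) linorder_not_le subsetI)
  have "inj_on (f(j := z)) (insert j I)"
    using f(1) z(2) insert.hyps(2) by (auto simp: inj_on_def)
  moreover have "\<forall>i\<in>insert j I. (f(j := z)) i \<in> F i"
    using f(2) z(1) by simp
  ultimately show ?case by blast
qed

lemma card_insert_Diff:
  assumes "finite A" "a \<in> A" "b \<notin> A - {a}"
  shows "card (insert b (A - {a})) = card A"
  using assms by (metis card_Suc_Diff1 card_insert_disjoint finite_Diff)

text \<open>Choose one point \<open>(i, f i)\<close> in each of the first \<open>k\<close> rows, in
  distinct columns, and replace it by \<open>(i, n)\<close> and \<open>(n, f i)\<close>. Row
  \<open>i\<close> and column \<open>f i\<close> lose a point and gain one, the new row and column
  receive \<open>k\<close> points each, and a line of slope other than 0 and infinity meets the new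
  row and the new column at most once each.\<close>

lemma regular_spread_Suc:
  assumes S: "regular_spread n k c S" and "k \<le> n"
  shows "\<exists>S'. regular_spread (Suc n) k (c + 2) S'"
proof -
  define I where "I = {0..<int k}"
  note sub = regular_spreadD(1)[OF S] and row = regular_spreadD(2)[OF S]
    and col = regular_spreadD(3)[OF S] and lin = regular_spreadD(4)[OF S]
  have fin: "finite S" using sub finite_subset by blast
  have fin_row: "finite {y. (x, y) \<in> S}" for x
    by (rule finite_subset[of _ "{0..<int n}"]) (use sub in auto)
  have fin_col: "finite {x. (x, y) \<in> S}" for y
    by (rule finite_subset[of _ "{0..<int n}"]) (use sub in auto)
  have "\<exists>f. inj_on f I \<and> (\<forall>i\<in>I. f i \<in> {y. (i, y) \<in> S})"
    by (rule ex_distinct_representatives) (use assms(2) row in \<open>auto simp: I_def\<close>)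
  then obtain f where inj: "inj_on f I" and f: "\<And>i. i \<in> I \<Longrightarrow> (i, f i) \<in> S" by auto
  define S' where "S' = (S - (\<lambda>i. (i, f i)) ` I) \<union> (\<lambda>i. (i, int n)) ` I \<union> (\<lambda>i. (int n, f i)) ` I"
  have In: "i < int n" "0 \<le> i" "f i < int n" "0 \<le> f i" if "i \<in> I" for i
    using f[OF that] sub that by auto
  have row': "card {y. (x, y) \<in> S'} = k" if x: "x \<in> {0..<int (Suc n)}" for x
  proof (cases "x = int n")
    case True
    then have "{y. (x, y) \<in> S'} = f ` I"
      using sub In by (auto simp: S'_def)
    then show ?thesis using card_image[OF inj] by (simp add: I_def)
  next
    case False
    with x have xn: "x \<in> {0..<int n}" by auto
    show ?thesis
    proof (cases "x \<in> I")
      case True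
      have "{y. (x, y) \<in> S'} = insert (int n) ({y. (x, y) \<in> S} - {f x})"
        using True False by (auto simp: S'_def)
      moreover have "int n \<notin> {y. (x, y) \<in> S} - {f x}" using sub by auto
      ultimately show ?thesis
        using row[OF xn] f[OF True] fin_row[of x] card_insert_Diff[of "{y. (x, y) \<in> S}" "f x" "int n"] by simp
    next
      case notI: False
      then have "{y. (x, y) \<in> S'} = {y. (x, y) \<in> S}"
        using False by (auto simp: S'_def)
      then show ?thesis using row[OF xn] by simp
    qed
  qed
  have col': "card {x. (x, y) \<in> S'} = k" if y: "y \<in> {0..<int (Suc n)}" for y
  proof (cases "y = int n")
    case True
    then have "(x, y) \<notin> S" "x \<in> I \<Longrightarrow> y \<noteq> f x" for x
      using sub In(3)[of x] by auto
    then have "{x. (x, y) \<in> S'} = I"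
      using True In(3) by (auto simp: S'_def)
    then show ?thesis by (simp add: I_def)
  next
    case False
    with y have yn: "y \<in> {0..<int n}" by auto
    show ?thesis
    proof (cases "y \<in> f ` I")
      case True
      then obtain i where i: "i \<in> I" "y = f i" by auto
      have "{x. (x, y) \<in> S'} = insert (int n) ({x. (x, y) \<in> S} - {i})"
        using i False inj by (auto simp: S'_def inj_on_def)
      moreover have "int n \<notin> {x. (x, y) \<in> S} - {i}" using sub by auto
      ultimately show ?thesis
        using col[OF yn] f[OF i(1)] fin_col[of y] i card_insert_Diff[of "{x. (x, y) \<in> S}" i "int n"] by simp
    next
      case notI: False
      then have "{x. (x, y) \<in> S'} = {x. (x, y) \<in> S}"
        using False by (auto simp: S'_def)
      then show ?thesis using col[OF yn] by simp
    qed
  qed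
  have lin': "card {t. (x0 + t * u, y0 + t * v) \<in> S'} \<le> c + 2" if uv: "u > 0" "v \<noteq> 0" for x0 y0 u v
  proof -
    let ?A = "{t. (x0 + t * u, y0 + t * v) \<in> S}"
    let ?B = "{t. x0 + t * u = int n}" and ?C = "{t. y0 + t * v = int n}"
    have c1: "card X \<le> 1 \<and> finite X" if "\<And>s t. s \<in> X \<Longrightarrow> t \<in> X \<Longrightarrow> s = t" for X :: "int set"
    proof (cases "X = {}")
      case False
      then obtain x where "x \<in> X" by blast
      then have "X = {x}" using that by blast
      then show ?thesis by simp
    qed simp
    have cancel: "s = t" if "a + s * w = b" "a + t * w = b" "w \<noteq> 0" for a b w s t :: int
      using that by (metis add_left_cancel mult_right_cancel)
    have B: "card ?B \<le> 1 \<and> finite ?B"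
      by (rule c1, rule cancel[of x0 _ u "int n"]) (use uv in auto)
    have C: "card ?C \<le> 1 \<and> finite ?C"
      by (rule c1, rule cancel[of y0 _ v "int n"]) (use uv in auto)
    have A: "finite ?A" using finite_line_params[OF fin] uv by simp
    have "{t. (x0 + t * u, y0 + t * v) \<in> S'} \<subseteq> ?A \<union> (?B \<union> ?C)"
      by (auto simp: S'_def)
    then have "card {t. (x0 + t * u, y0 + t * v) \<in> S'} \<le> card (?A \<union> (?B \<union> ?C))"
      by (rule card_mono[rotated]) (use A B C in auto)
    also have "\<dots> \<le> card ?A + (card ?B + card ?C)"
      using card_Un_le[of ?A "?B \<union> ?C"] card_Un_le[of ?B ?C] by linarith
    also have "\<dots> \<le> c + 2" using B C lin[OF uv, of x0 y0] by linarith
    finally show ?thesis .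
  qed
  have "S' \<subseteq> {0..<int (Suc n)} \<times> {0..<int (Suc n)}"
  proof -
    have "{0..<int n} \<subseteq> {0..<int (Suc n)}" "int n \<in> {0..<int (Suc n)}" by auto
    moreover have "\<And>i. i \<in> I \<Longrightarrow> i \<in> {0..<int n} \<and> f i \<in> {0..<int n}" using In by simp
    ultimately show ?thesis using sub unfolding S'_def by blast
  qed
  then have "regular_spread (Suc n) k (c + 2) S'"
    using row' col' lin' by (simp add: regular_spread_def)
  then show ?thesis by blast
qed

lemma regular_spread_add:
  assumes "regular_spread n k c S" "k \<le> n"
  shows "\<exists>S'. regular_spread (n + r) k (c + 2 * r) S'"
proof (induction r)
  case 0
  then show ?case using assms(1) by auto
next
  case (Suc r)
  then obtain S' where "regular_spread (n + r) k (c + 2 * r) S'" by blast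
  from regular_spread_Suc[OF this] assms(2) show ?case by auto
qed

lemma regular_spread_mono:
  assumes "regular_spread n k c S" "c \<le> c'"
  shows "regular_spread n k c' S"
  using assms by (fastforce simp: regular_spread_def intro: le_trans)

section \<open>From integer progressions to Euclidean lines\<close>

text \<open>The determinant form covers vertical lines as well and, on grid points, becomes an
  equation between integers.\<close>

lemma line_cross:
  fixes L :: "(real \<times> real) set"
  assumes "is_line L" "P \<in> L" "Q \<in> L" "R \<in> L"
  shows "(fst R - fst P) * (snd Q - snd P) = (snd R - snd P) * (fst Q - fst P)"
proof -
  have "collinear L" using assms(1) by (simp add: is_line_def collinear_aff_dim)
  then obtain w where w: "\<And>x y. x \<in> L \<Longrightarrow> y \<in> L \<Longrightarrow> \<exists>c. x - y = c *\<^sub>R w"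
    unfolding collinear_def by blast
  obtain c where c: "Q - P = c *\<^sub>R w" using w assms by blast
  obtain d where d: "R - P = d *\<^sub>R w" using w assms by blast
  have "fst R - fst P = d * fst w" "snd R - snd P = d * snd w"
    using d by (metis fst_diff fst_scaleR real_scaleR_def) (metis d snd_diff snd_scaleR real_scaleR_def)
  moreover have "fst Q - fst P = c * fst w" "snd Q - snd P = c * snd w"
    using c by (metis fst_diff fst_scaleR real_scaleR_def) (metis c snd_diff snd_scaleR real_scaleR_def)
  ultimately show ?thesis by simp
qed

definition grid_point :: "int \<times> int \<Rightarrow> real \<times> real" where
  "grid_point p = (real_of_int (fst p + 1), real_of_int (snd p + 1))"

lemma inj_grid_point: "inj grid_point"
  by (auto simp: inj_def grid_point_def prod_eq_iff)

text \<open>Two distinct points of the set determine the line. Unless it is a row or a column, its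
  grid points form a progression whose step is the primitive vector in its direction, so
  \<open>regular_spread\<close> applies. A line with at most one point is harmless because
  \<open>k \<ge> 1\<close>.\<close>

lemma regular_spread_at_most_on_lines:
  assumes S: "regular_spread n k k S" and "k \<ge> 1"
  shows "at_most_on_lines k (grid_point ` S)"
  unfolding at_most_on_lines_def
proof (intro allI impI)
  fix L assume L: "is_line L"
  note sub = regular_spreadD(1)[OF S] and row = regular_spreadD(2)[OF S]
    and col = regular_spreadD(3)[OF S] and lin = regular_spreadD(4)[OF S]
  have fin: "finite S" using sub finite_subset by blast
  define A where "A = {p \<in> S. grid_point p \<in> L}"
  have finA: "finite A" using fin by (simp add: A_def)
  have "grid_point ` S \<inter> L = grid_point ` A" by (auto simp: A_def)
  then have card_eq: "card (grid_point ` S \<inter> L) = card A"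
    by (simp add: card_image inj_on_subset[OF inj_grid_point])
  have "card A \<le> k"
  proof (cases "\<exists>p\<in>A. \<exists>p'\<in>A. p \<noteq> p'")
    case False
    then have "card A \<le> 1"
      by (metis One_nat_def card_le_Suc0_iff_eq finA)
    then show ?thesis using assms(2) by simp
  next
    case True
    then obtain p p' where p: "p \<in> A" "p' \<in> A" "p \<noteq> p'" "fst p \<le> fst p'"
      by (metis linear)
    define x0 where "x0 = fst p"
    define y0 where "y0 = snd p"
    define U where "U = fst p' - fst p"
    define V where "V = snd p' - snd p"
    have cross: "(fst r - x0) * V = (snd r - y0) * U" if "r \<in> A" for r
    proof -
      have "(real_of_int (fst r + 1) - real_of_int (fst p + 1)) * (real_of_int (snd p' + 1) - real_of_int (snd p + 1))
        = (real_of_int (snd r + 1) - real_of_int (snd p + 1)) * (real_of_int (fst p' + 1) - real_of_int (fst p + 1))"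
        using line_cross[OF L, of "grid_point p" "grid_point p'" "grid_point r"] p that
        by (simp add: A_def grid_point_def)
      then have "real_of_int ((fst r - x0) * V) = real_of_int ((snd r - y0) * U)"
        by (simp add: x0_def y0_def U_def V_def)
      then show ?thesis using of_int_eq_iff by blast
    qed
    have p_in: "p \<in> S" using p by (simp add: A_def)
    then have x0y0: "x0 \<in> {0..<int n}" "y0 \<in> {0..<int n}" using sub by (auto simp: x0_def y0_def)
    have UV: "U \<noteq> 0 \<or> V \<noteq> 0" using p(3) by (auto simp: U_def V_def prod_eq_iff)
    have U: "U \<ge> 0" using p(4) by (simp add: U_def)
    consider "U = 0" | "V = 0" "U \<noteq> 0" | "U > 0" "V \<noteq> 0" using U by linarith
    then show ?thesis
    proof cases
      case 1
      have "A \<subseteq> Pair x0 ` {y. (x0, y) \<in> S}"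
      proof
        fix r assume r: "r \<in> A"
        have "fst r = x0" using cross[OF r] 1 UV by simp
        then have "(x0, snd r) \<in> S" "r = (x0, snd r)" using r by (auto simp: A_def)
        then show "r \<in> Pair x0 ` {y. (x0, y) \<in> S}" by blast
      qed
      \<comment> \<open>An infinite set would have \<open>card\<close> equal to 0, whereas this one
        has \<open>card\<close> equal to \<open>k \<ge> 1\<close>.\<close>
      moreover have "finite {y. (x0, y) \<in> S}"
        using row[OF x0y0(1)] assms(2) by (metis card.infinite not_one_le_zero)
      ultimately show ?thesis using row[OF x0y0(1)] by (metis surj_card_le)
    next
      case 2
      have "A \<subseteq> (\<lambda>x. (x, y0)) ` {x. (x, y0) \<in> S}"
      proof
        fix r assume r: "r \<in> A"
        have "snd r = y0" using cross[OF r] 2 by simp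
        then have "(fst r, y0) \<in> S" "r = (fst r, y0)" using r by (auto simp: A_def)
        then show "r \<in> (\<lambda>x. (x, y0)) ` {x. (x, y0) \<in> S}" by blast
      qed
      moreover have "finite {x. (x, y0) \<in> S}"
        using col[OF x0y0(2)] assms(2) by (metis card.infinite not_one_le_zero)
      ultimately show ?thesis using col[OF x0y0(2)] by (metis surj_card_le)
    next
      case 3
      \<comment> \<open>With the direction in lowest terms, \<open>u\<close> divides
        \<open>fst r - x0\<close> for every \<open>r\<close> in \<open>A\<close>, so the parameter
        of \<open>r\<close> is an integer.\<close>
      define g where "g = gcd U V"
      have "g \<noteq> 0" using 3 by (simp add: g_def)
      then have g: "g > 0" unfolding g_def using gcd_ge_0_int[of U V] by linarith
      obtain u v where uv: "U = u * g" "V = v * g" "coprime u v"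
        using gcd_coprime_exists[of U V] \<open>g \<noteq> 0\<close> unfolding g_def by metis
      have upos: "u > 0" using 3 uv g by (simp add: zero_less_mult_iff)
      have v0: "v \<noteq> 0" using 3 uv by auto
      have "A \<subseteq> (\<lambda>t. (x0 + t * u, y0 + t * v)) ` {t. (x0 + t * u, y0 + t * v) \<in> S}"
      proof
        fix r assume r: "r \<in> A"
        have e: "(fst r - x0) * v = (snd r - y0) * u"
          using cross[OF r] g by (simp add: uv)
        then have "u dvd (fst r - x0) * v" by simp
        then have "u dvd fst r - x0" using uv(3) by (simp add: coprime_dvd_mult_left_iff)
        then obtain t where t: "fst r - x0 = u * t" ..
        have "(snd r - y0) * u = t * v * u" using e t by (simp add: algebra_simps)
        then have "snd r - y0 = t * v" using upos by simp
        then have "r = (x0 + t * u, y0 + t * v)" using t by (simp add: prod_eq_iff algebra_simps)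
        then show "r \<in> (\<lambda>t. (x0 + t * u, y0 + t * v)) ` {t. (x0 + t * u, y0 + t * v) \<in> S}"
          using r by (auto simp: A_def)
      qed
      moreover have "finite {t. (x0 + t * u, y0 + t * v) \<in> S}"
        using finite_line_params[OF fin] upos by simp
      ultimately show ?thesis using lin[OF upos v0] by (meson le_trans surj_card_le)
    qed
  qed
  then show "card (grid_point ` S \<inter> L) \<le> k" using card_eq by simp
qed

lemma is_line_horizontal: "is_line {p :: real \<times> real. snd p = c}"
proof -
  have *: "{p :: real \<times> real. snd p = c} = {p. (0, 1) \<bullet> p = c}"
    by (auto simp: inner_prod_def)
  have "affine {p :: real \<times> real. (0, 1) \<bullet> p = c}" by (rule affine_hyperplane)
  moreover have "aff_dim {p :: real \<times> real. (0, 1) \<bullet> p = c} = 1"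
    using aff_dim_hyperplane[of "(0, 1) :: real \<times> real" c] by (simp add: zero_prod_def)
  ultimately show ?thesis unfolding is_line_def * by blast
qed

text \<open>The \<open>n\<close> horizontal lines through the grid points cover the grid.\<close>

lemma card_le_of_at_most_on_lines:
  assumes "S \<subseteq> grid n" "at_most_on_lines k S"
  shows "card S \<le> k * n"
proof -
  have "S \<subseteq> (\<Union>j\<in>{1..n}. S \<inter> {p. snd p = real j})"
    using assms(1) by (force simp: grid_def)
  moreover have "finite S" using assms(1) finite_grid finite_subset by blast
  ultimately have "card S \<le> card (\<Union>j\<in>{1..n}. S \<inter> {p. snd p = real j})"
    by (intro card_mono) auto
  also have "\<dots> \<le> (\<Sum>j\<in>{1..n}. card (S \<inter> {p. snd p = real j}))"
    by (rule card_UN_le) simp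
  also have "\<dots> \<le> (\<Sum>j\<in>{1..n}. k)"
    by (rule sum_mono) (use assms(2) is_line_horizontal in \<open>auto simp: at_most_on_lines_def\<close>)
  finally show ?thesis by (simp add: mult.commute)
qed

text \<open>Summing the \<open>k\<close> points of each row yields \<open>k * n\<close> points,
  which meets the bound from the horizontal lines.\<close>

lemma max_points_eq_of_regular_spread:
  assumes S: "regular_spread n k k S" and "k \<ge> 1"
  shows "max_points k n = k * n"
proof -
  note sub = regular_spreadD(1)[OF S] and row = regular_spreadD(2)[OF S]
  have Sigma: "(SIGMA x:{0..<int n}. {y. (x, y) \<in> S}) = S" using sub by auto
  have fin: "finite {y. (x, y) \<in> S}" for x
    by (rule finite_subset[of _ "{0..<int n}"]) (use sub in auto)
  have "card (SIGMA x:{0..<int n}. {y. (x, y) \<in> S}) = (\<Sum>x\<in>{0..<int n}. card {y. (x, y) \<in> S})"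
    by (rule card_SigmaI) (use fin in auto)
  then have "card S = (\<Sum>x\<in>{0..<int n}. card {y. (x, y) \<in> S})"
    by (simp only: Sigma)
  also have "\<dots> = k * n" using row by simp
  finally have "card S = k * n" .
  then have card: "card (grid_point ` S) = k * n"
    by (simp add: card_image inj_on_subset[OF inj_grid_point])
  have "grid_point p \<in> grid n" if "p \<in> S" for p
  proof -
    have "fst p \<in> {0..<int n}" "snd p \<in> {0..<int n}" using sub that by auto
    then have "nat (fst p + 1) \<in> {1..n}" "nat (snd p + 1) \<in> {1..n}"
      and "grid_point p = (real (nat (fst p + 1)), real (nat (snd p + 1)))"
      by (auto simp: grid_point_def)
    then show ?thesis unfolding grid_def mem_Collect_eq
      by (rule_tac x = "nat (fst p + 1)" in exI, rule_tac x = "nat (snd p + 1)" in exI) simp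
  qed
  then have "grid_point ` S \<subseteq> grid n" by blast
  then have mem: "k * n \<in> {card S |S. S \<subseteq> grid n \<and> at_most_on_lines k S}"
    using regular_spread_at_most_on_lines[OF assms] card
    by (simp only: mem_Collect_eq) (intro exI[of _ "grid_point ` S"] conjI, simp_all)
  show ?thesis unfolding max_points_def
  proof (rule Max_eqI[OF max_points_wf(1) _ mem])
    fix y assume "y \<in> {card S |S. S \<subseteq> grid n \<and> at_most_on_lines k S}"
    then obtain S where "S \<subseteq> grid n" "at_most_on_lines k S" "y = card S"
      unfolding mem_Collect_eq by (elim exE conjE)
    then show "y \<le> k * n" using card_le_of_at_most_on_lines by simp
  qed
qed

subsection \<open>Progressions and residue windows\<close>

lemma finite_filter: "finite A \<Longrightarrow> finite {t \<in> A. P t}"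
  by simp

text \<open>The parameters fill a half-open real interval of length \<open>(r - p) / d\<close>,
  which contains at most one integer more than its length.\<close>

lemma card_progression_window:
  fixes p r w d :: int
  assumes "d > 0" "p \<le> r"
  shows "real (card {t. p \<le> w + t * d \<and> w + t * d < r}) \<le> real_of_int (r - p) / d + 1"
proof -
  define \<alpha> where "\<alpha> = (real_of_int p - w) / d"
  define \<beta> where "\<beta> = (real_of_int r - w) / d"
  have d: "real_of_int d > 0" using assms(1) by simp
  have "{t. p \<le> w + t * d \<and> w + t * d < r} \<subseteq> {\<lceil>\<alpha>\<rceil>..<\<lceil>\<beta>\<rceil>}"
  proof
    fix t assume "t \<in> {t. p \<le> w + t * d \<and> w + t * d < r}"
    then have "real_of_int p \<le> real_of_int (w + t * d)" "real_of_int (w + t * d) < real_of_int r"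
      by (simp_all only: of_int_le_iff of_int_less_iff mem_Collect_eq)
    then have "\<alpha> \<le> t" "t < \<beta>" using d by (simp_all add: \<alpha>_def \<beta>_def field_simps)
    then show "t \<in> {\<lceil>\<alpha>\<rceil>..<\<lceil>\<beta>\<rceil>}" by (simp add: ceiling_le_iff less_ceiling_iff)
  qed
  then have "card {t. p \<le> w + t * d \<and> w + t * d < r} \<le> nat (\<lceil>\<beta>\<rceil> - \<lceil>\<alpha>\<rceil>)"
    by (metis card_atLeastLessThan_int card_mono finite_atLeastLessThan_int)
  moreover have "\<alpha> \<le> \<beta>" using assms(2) d by (simp add: \<alpha>_def \<beta>_def divide_right_mono)
  then have "\<lceil>\<alpha>\<rceil> \<le> \<lceil>\<beta>\<rceil>" by (rule ceiling_mono)
  ultimately have "real (card {t. p \<le> w + t * d \<and> w + t * d < r}) \<le> real_of_int (\<lceil>\<beta>\<rceil> - \<lceil>\<alpha>\<rceil>)"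
    by linarith
  also have "\<dots> \<le> \<beta> - \<alpha> + 1" by linarith
  also have "\<beta> - \<alpha> = real_of_int (r - p) / d" by (simp add: \<alpha>_def \<beta>_def diff_divide_distrib)
  finally show ?thesis by simp
qed

text \<open>A progression spanning one full period meets a residue window in at most two pieces of total
  length \<open>\<kappa>\<close>; \<open>E\<close> is the excess over one period.\<close>

lemma card_progression_residue_window:
  fixes w d h \<kappa> t1 t2 :: int and E :: real
  assumes d: "d > 0" and \<kappa>: "0 \<le> \<kappa>" "\<kappa> \<le> h" and h: "h > 0" and E: "E \<ge> 0"
    and span: "real_of_int ((t2 - t1) * d) \<le> h + E"
  shows "real (card {t \<in> {t1..t2}. (w - t * d) mod h < \<kappa>}) \<le> (\<kappa> + E) / d + 4"
proof -
  \<comment> \<open>Counting backwards from \<open>t2\<close> by \<open>s = t2 - t\<close> turns the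
    residues into those of the increasing progression \<open>z + s * d\<close>, which starts inside
    \<open>[0, h)\<close>.\<close>
  define z where "z = (w - t2 * d) mod h"
  have z: "0 \<le> z" "z < h" using h by (simp_all add: z_def)
  \<comment> \<open>\<open>e\<close> is an integer exceeding \<open>E\<close>, so the real span
    bound becomes \<open>s * d < h + e\<close>.\<close>
  define e where "e = \<lfloor>E\<rfloor> + 1"
  have e: "real_of_int e \<le> E + 1" "E < real_of_int e" unfolding e_def by linarith+
  let ?P = "\<lambda>p r. {s. p \<le> z + s * d \<and> z + s * d < r}"
  have fin: "finite (?P p r)" for p r
  proof (rule finite_subset)
    show "?P p r \<subseteq> {- \<bar>p\<bar> - \<bar>z\<bar> .. \<bar>r\<bar> + \<bar>z\<bar>}"
    proof
      fix s assume s: "s \<in> ?P p r"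
      show "s \<in> {- \<bar>p\<bar> - \<bar>z\<bar> .. \<bar>r\<bar> + \<bar>z\<bar>}"
      proof (cases "s \<ge> 0")
        case True
        have "s * 1 \<le> s * d" using True d by (intro mult_left_mono) auto
        then show ?thesis using s True by auto
      next
        case False
        then have "s * d \<le> s * 1" using d by (intro mult_left_mono_neg) auto
        then show ?thesis using s False by (simp only: mem_Collect_eq atLeastAtMost_iff) linarith
      qed
    qed
  qed simp
  \<comment> \<open>The windows are the stretch before the first wrap, the stretch from there to a
    full period, and the excess. The first two have total length \<open>\<kappa>\<close>, since
    \<open>max \<kappa> z + min \<kappa> z = \<kappa> + z\<close>. Each window costs an extra 1 and
    rounding \<open>E\<close> costs another, hence the 4.\<close>
  have "(\<lambda>t. t2 - t) ` {t \<in> {t1..t2}. (w - t * d) mod h < \<kappa>}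
          \<subseteq> ?P z (max \<kappa> z) \<union> ?P h (h + min \<kappa> z) \<union> ?P (z + h) (z + h + e)"
  proof
    fix s assume "s \<in> (\<lambda>t. t2 - t) ` {t \<in> {t1..t2}. (w - t * d) mod h < \<kappa>}"
    then obtain t where t: "t1 \<le> t" "t \<le> t2" "(w - t * d) mod h < \<kappa>" "s = t2 - t" by auto
    have s0: "s \<ge> 0" using t by simp
    have sd0: "s * d \<ge> 0" using s0 d by simp
    have "s * d \<le> (t2 - t1) * d" using t d by simp
    then have "real_of_int (s * d) \<le> h + E" using span by linarith
    then have up: "s * d < h + e" using e by linarith
    have "t2 = s + t" using t(4) by simp
    then have eq: "w - t2 * d + s * d = w - t * d" by (simp add: algebra_simps)
    have "(z + s * d) mod h = (w - t * d) mod h" by (simp only: z_def mod_add_left_eq eq)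
    then have m: "(z + s * d) mod h < \<kappa>" using t(3) by simp
    consider "z + s * d \<ge> z + h" | "z + s * d < h" | "h \<le> z + s * d" "z + s * d < z + h" by linarith
    then show "s \<in> ?P z (max \<kappa> z) \<union> ?P h (h + min \<kappa> z) \<union> ?P (z + h) (z + h + e)"
    proof cases
      case 1
      then show ?thesis using up by simp
    next
      case 2
      then have "(z + s * d) mod h = z + s * d" using z sd0 by simp
      then show ?thesis using m sd0 2 by (auto simp: max_def)
    next
      case 3
      have "(z + s * d) mod h = (z + s * d - h) mod h" by simp
      also have "\<dots> = z + s * d - h" using 3 z by (intro mod_pos_pos_trivial) auto
      finally show ?thesis using m 3 by (auto simp: min_def)
    qed
  qed
  then have "card ((\<lambda>t. t2 - t) ` {t \<in> {t1..t2}. (w - t * d) mod h < \<kappa>})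
     \<le> card (?P z (max \<kappa> z) \<union> ?P h (h + min \<kappa> z) \<union> ?P (z + h) (z + h + e))"
    by (rule card_mono[rotated]) (intro finite_UnI fin)
  also have "\<dots> \<le> card (?P z (max \<kappa> z)) + card (?P h (h + min \<kappa> z)) + card (?P (z + h) (z + h + e))"
    using card_Un_le[of "?P z (max \<kappa> z) \<union> ?P h (h + min \<kappa> z)" "?P (z + h) (z + h + e)"]
      card_Un_le[of "?P z (max \<kappa> z)" "?P h (h + min \<kappa> z)"] by linarith
  finally have le: "card {t \<in> {t1..t2}. (w - t * d) mod h < \<kappa>}
     \<le> card (?P z (max \<kappa> z)) + card (?P h (h + min \<kappa> z)) + card (?P (z + h) (z + h + e))"
    by (subst (asm) card_image) (auto simp: inj_on_def)
  have dr: "real_of_int d > 0" using d by simp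
  have "real (card (?P z (max \<kappa> z))) \<le> real_of_int (max \<kappa> z - z) / d + 1"
    by (rule card_progression_window) (use d in auto)
  moreover have "real (card (?P h (h + min \<kappa> z))) \<le> real_of_int (h + min \<kappa> z - h) / d + 1"
    by (rule card_progression_window) (use d z \<kappa> in auto)
  moreover have "real (card (?P (z + h) (z + h + e))) \<le> real_of_int (z + h + e - (z + h)) / d + 1"
    by (rule card_progression_window) (use d e E in auto)
  moreover have "real_of_int (z + h + e - (z + h)) / d \<le> E / d + 1"
  proof -
    have "real_of_int (z + h + e - (z + h)) / d \<le> (E + 1) / d"
      using e dr by (intro divide_right_mono) auto
    also have "\<dots> \<le> E / d + 1" using d by (simp add: add_divide_distrib)
    finally show ?thesis .
  qed
  ultimately have "real (card {t \<in> {t1..t2}. (w - t * d) mod h < \<kappa>})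
    \<le> real_of_int (max \<kappa> z - z) / d + real_of_int (h + min \<kappa> z - h) / d + E / d + 4"
    using le by linarith
  also have "\<dots> = (\<kappa> + E) / d + 4"
    by (simp add: add_divide_distrib[symmetric] max_def min_def)
  finally show ?thesis .
qed

text \<open>The parameters are split by the value of \<open>(x0 + t * u) div m\<close>. Inside such
  a group the residue is that of \<open>w - t * (q * u - v)\<close> with \<open>w\<close> constant,
  and \<open>t * u\<close> varies by less than \<open>m\<close>, so the progression spans at most
  one period \<open>q * m\<close> plus the excess \<open>m * |v| / u\<close>. The residue window
  bound applies to each group.\<close>

lemma card_strip:
  fixes q m u v \<kappa> x0 y0 t1 t2 :: int
  assumes q: "q > 0" and m: "m > 0" and u: "u > 0" and d: "v < q * u"
    and \<kappa>: "0 \<le> \<kappa>" "\<kappa> \<le> q * m" and t12: "t1 \<le> t2"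
  shows "real (card {t \<in> {t1..t2}.
            (y0 + t * v - q * ((x0 + t * u) mod m) - (x0 + t * u) div m) mod (q * m) < \<kappa>})
         \<le> (real_of_int ((t2 - t1) * u) / m + 2) * ((\<kappa> + real_of_int m * \<bar>v\<bar> / u) / real_of_int (q * u - v) + 4)"
proof -
  let ?hit = "\<lambda>t. (y0 + t * v - q * ((x0 + t * u) mod m) - (x0 + t * u) div m) mod (q * m) < \<kappa>"
  define bd where "bd = (\<kappa> + real_of_int m * \<bar>v\<bar> / u) / real_of_int (q * u - v) + 4"
  have "real_of_int (q * u - v) \<ge> 0" using d by (simp only: of_int_0_le_iff)
  then have bd0: "bd \<ge> 0"
    unfolding bd_def using \<kappa> m u by (intro add_nonneg_nonneg divide_nonneg_nonneg) simp_all
  have group: "real (card {t \<in> {t1..t2}. (x0 + t * u) div m = A \<and> ?hit t}) \<le> bd" for A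
  proof (cases "{t \<in> {t1..t2}. (x0 + t * u) div m = A} = {}")
    case True
    then have "{t \<in> {t1..t2}. (x0 + t * u) div m = A \<and> ?hit t} = {}" by blast
    then show ?thesis using bd0 by (simp only: card.empty)
  next
    case False
    let ?C = "{t \<in> {t1..t2}. (x0 + t * u) div m = A}"
    define s1 s2 where "s1 = Min ?C" and "s2 = Max ?C"
    have finC: "finite ?C" by (rule finite_filter) simp
    have s1: "s1 \<in> ?C" and s2: "s2 \<in> ?C" unfolding s1_def s2_def
      using Min_in[OF finC False] Max_in[OF finC False] by blast+
    have btw: "s1 \<le> t \<and> t \<le> s2" if "t \<in> ?C" for t
      unfolding s1_def s2_def using Min_le[OF finC that] Max_ge[OF finC that] by blast
    have modC: "(x0 + t * u) mod m = x0 + t * u - A * m" if "t \<in> ?C" for t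
      using that by (auto simp: minus_div_mult_eq_mod[symmetric])
    have s12: "s1 \<le> s2" using btw[OF s1] by simp
    have "x0 + s2 * u - A * m < m" "x0 + s1 * u - A * m \<ge> 0"
      using modC[OF s1] modC[OF s2] pos_mod_bound[OF m] pos_mod_sign[OF m] by metis+
    then have su: "(s2 - s1) * u < m" by (simp add: algebra_simps)
    define w where "w = y0 - q * x0 + q * (A * m) - A"
    have "{t \<in> {t1..t2}. (x0 + t * u) div m = A \<and> ?hit t}
            \<subseteq> {t \<in> {s1..s2}. (w - t * (q * u - v)) mod (q * m) < \<kappa>}"
    proof
      fix t assume t: "t \<in> {t \<in> {t1..t2}. (x0 + t * u) div m = A \<and> ?hit t}"
      then have tC: "t \<in> ?C" by blast
      then have divA: "(x0 + t * u) div m = A" by blast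
      have "y0 + t * v - q * ((x0 + t * u) mod m) - (x0 + t * u) div m = w - t * (q * u - v)"
        unfolding modC[OF tC] divA w_def by (simp add: algebra_simps)
      then show "t \<in> {t \<in> {s1..s2}. (w - t * (q * u - v)) mod (q * m) < \<kappa>}"
        using t btw[OF tC] by simp
    qed
    then have "card {t \<in> {t1..t2}. (x0 + t * u) div m = A \<and> ?hit t}
            \<le> card {t \<in> {s1..s2}. (w - t * (q * u - v)) mod (q * m) < \<kappa>}"
      by (rule card_mono[rotated]) (rule finite_filter, simp)
    moreover have "real (card {t \<in> {s1..s2}. (w - t * (q * u - v)) mod (q * m) < \<kappa>})
      \<le> (\<kappa> + real_of_int m * \<bar>v\<bar> / u) / real_of_int (q * u - v) + 4"
    proof (rule card_progression_residue_window)
      show "0 \<le> real_of_int m * \<bar>v\<bar> / u" using m u by simp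
      have "real_of_int (s2 - s1) * u \<le> m" using su by (metis less_imp_le of_int_le_iff of_int_mult)
      then have "real_of_int (s2 - s1) \<le> m / u" using u by (simp add: field_simps)
      then have "real_of_int (s2 - s1) * \<bar>v\<bar> \<le> real_of_int m / u * \<bar>v\<bar>" by (intro mult_right_mono) auto
      then have 1: "real_of_int (s2 - s1) * \<bar>v\<bar> \<le> real_of_int m * \<bar>v\<bar> / u" by simp
      have "real_of_int ((s2 - s1) * (q * u - v)) = real_of_int (q * ((s2 - s1) * u)) - real_of_int (s2 - s1) * v"
        by (simp add: algebra_simps)
      moreover have "q * ((s2 - s1) * u) \<le> q * m" using su q by (intro mult_left_mono) auto
      then have "real_of_int (q * ((s2 - s1) * u)) \<le> real_of_int (q * m)" by (simp only: of_int_le_iff)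
      moreover have "- (real_of_int (s2 - s1) * v) \<le> real_of_int (s2 - s1) * \<bar>v\<bar>"
        using s12 by (metis abs_ge_minus_self mult_left_mono mult_minus_right of_int_0_le_iff of_int_minus
            of_int_le_iff diff_ge_0_iff_ge)
      ultimately show "real_of_int ((s2 - s1) * (q * u - v)) \<le> real_of_int (q * m) + real_of_int m * \<bar>v\<bar> / u"
        using 1 by linarith
    qed (use assms in auto)
    ultimately show ?thesis unfolding bd_def by linarith
  qed
  define A1 A2 where "A1 = (x0 + t1 * u) div m" and "A2 = (x0 + t2 * u) div m"
  have "{t \<in> {t1..t2}. ?hit t} \<subseteq> (\<Union>A\<in>{A1..A2}. {t \<in> {t1..t2}. (x0 + t * u) div m = A \<and> ?hit t})"
  proof
    fix t assume t: "t \<in> {t \<in> {t1..t2}. ?hit t}"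
    then have "t1 * u \<le> t * u" "t * u \<le> t2 * u" using u by auto
    then have "(x0 + t * u) div m \<in> {A1..A2}"
      unfolding A1_def A2_def using m by (auto intro!: zdiv_mono1)
    with t show "t \<in> (\<Union>A\<in>{A1..A2}. {t \<in> {t1..t2}. (x0 + t * u) div m = A \<and> ?hit t})" by blast
  qed
  then have "card {t \<in> {t1..t2}. ?hit t}
     \<le> card (\<Union>A\<in>{A1..A2}. {t \<in> {t1..t2}. (x0 + t * u) div m = A \<and> ?hit t})"
    by (rule card_mono[rotated]) (intro finite_UN_I finite_filter finite_atLeastAtMost_int)
  also have "\<dots> \<le> (\<Sum>A\<in>{A1..A2}. card {t \<in> {t1..t2}. (x0 + t * u) div m = A \<and> ?hit t})"
    by (rule card_UN_le) simp
  finally have "real (card {t \<in> {t1..t2}. ?hit t})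
    \<le> (\<Sum>A\<in>{A1..A2}. real (card {t \<in> {t1..t2}. (x0 + t * u) div m = A \<and> ?hit t}))"
    by (simp only: of_nat_sum[symmetric] of_nat_le_iff)
  also have "\<dots> \<le> (\<Sum>A\<in>{A1..A2}. bd)" by (rule sum_mono) (rule group)
  also have "\<dots> = real (nat (A2 - A1 + 1)) * bd" by simp
  also have "real (nat (A2 - A1 + 1)) * bd \<le> (real_of_int ((t2 - t1) * u) / m + 2) * bd"
  proof (rule mult_right_mono[OF _ bd0])
    have "t1 * u \<le> t2 * u" using t12 u by simp
    then have "A1 \<le> A2" unfolding A1_def A2_def using m by (intro zdiv_mono1) auto
    then have "real (nat (A2 - A1 + 1)) = real_of_int (A2 - A1 + 1)" by simp
    \<comment> \<open>Of the \<open>A2 - A1 + 1\<close> groups all but the first and the last are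
      crossed in full, hence the \<open>+ 2\<close>.\<close>
    moreover have "real_of_int (A2 - A1 - 1) \<le> real_of_int ((t2 - t1) * u) / m"
    proof -
      have "A2 * m \<le> x0 + t2 * u"
        unfolding A2_def using div_mult_mod_eq[of "x0 + t2 * u" m] pos_mod_sign[OF m, of "x0 + t2 * u"] by linarith
      moreover have "x0 + t1 * u < A1 * m + m"
        unfolding A1_def using div_mult_mod_eq[of "x0 + t1 * u" m] pos_mod_bound[OF m, of "x0 + t1 * u"] by linarith
      ultimately have "A2 * m - A1 * m - m \<le> (t2 - t1) * u" by (simp add: algebra_simps)
      then have "(A2 - A1 - 1) * m \<le> (t2 - t1) * u" by (simp add: left_diff_distrib)
      then have "real_of_int (A2 - A1 - 1) * m \<le> real_of_int ((t2 - t1) * u)"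
        by (metis of_int_le_iff of_int_mult)
      then show ?thesis using m by (simp add: pos_le_divide_eq)
    qed
    ultimately show "real (nat (A2 - A1 + 1)) \<le> real_of_int ((t2 - t1) * u) / m + 2" by linarith
  qed
  finally show ?thesis unfolding bd_def by simp
qed

subsection \<open>The block construction\<close>

text \<open>As \<open>x\<close> runs through \<open>h\<close> consecutive rows starting at a multiple of \<open>h\<close>, the number
  \<open>q * (x mod m) + x div m\<close> runs through all residues modulo \<open>h = q * m\<close> (transposition of the digits).\<close>

definition block_set :: "int \<Rightarrow> int \<Rightarrow> (int \<Rightarrow> int \<Rightarrow> int) \<Rightarrow> (int \<times> int) set" where
  "block_set q m K = {(x, y). x \<in> {0..<3 * (q * m)} \<and> y \<in> {0..<3 * (q * m)} \<and>
     (y - q * (x mod m) - x div m) mod (q * m) < K (x div (q * m)) (y div (q * m))}"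

lemma int_div_less:
  fixes a b m :: int
  assumes "a < b * m" "m > 0"
  shows "a div m < b"
proof (rule ccontr)
  assume "\<not> a div m < b"
  then have "b * m \<le> a div m * m" using assms(2) by (intro mult_right_mono) auto
  also have "\<dots> \<le> a" using div_mult_mod_eq[of a m] pos_mod_sign[OF assms(2), of a] by linarith
  finally show False using assms(1) by simp
qed

lemma card_three_blocks:
  fixes h :: int
  assumes h: "h > 0"
  shows "card {y \<in> {0..<3 * h}. P y} = (\<Sum>\<beta>\<in>{0..<3::int}. card {j \<in> {0..<h}. P (\<beta> * h + j)})"
proof -
  let ?S = "SIGMA \<beta>:{0..<3::int}. {j \<in> {0..<h}. P (\<beta> * h + j)}"
  let ?f = "\<lambda>(\<beta>, j). \<beta> * h + j"
  have dm: "(\<beta> * h + j) div h = \<beta>" "(\<beta> * h + j) mod h = j" if "j \<in> {0..<h}" for \<beta> j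
    using that h by simp_all
  have inj: "inj_on ?f ?S"
  proof (rule inj_onI)
    fix p p' assume p: "p \<in> ?S" "p' \<in> ?S" and eq: "?f p = ?f p'"
    obtain \<beta> j \<beta>' j' where pp: "p = (\<beta>, j)" "p' = (\<beta>', j')" by fastforce
    have "j \<in> {0..<h}" "j' \<in> {0..<h}" "\<beta> * h + j = \<beta>' * h + j'" using p eq pp by auto
    then have "\<beta> = \<beta>'" "j = j'" using dm by metis+
    then show "p = p'" using pp by simp
  qed
  have "{y \<in> {0..<3 * h}. P y} = ?f ` ?S"
  proof (intro equalityI subsetI)
    fix y assume y: "y \<in> {y \<in> {0..<3 * h}. P y}"
    have eq: "y div h * h + y mod h = y" by simp
    have "y div h < 3" using y h by (intro int_div_less) auto
    moreover have "y div h \<ge> 0" using y h by (simp add: pos_imp_zdiv_nonneg_iff)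
    ultimately have "(y div h, y mod h) \<in> ?S" using y h eq by auto
    then show "y \<in> ?f ` ?S" by (rule rev_image_eqI) (simp add: eq)
  next
    fix y assume "y \<in> ?f ` ?S"
    then obtain \<beta> j where b: "0 \<le> \<beta>" "\<beta> < 3" "0 \<le> j" "j < h" "P (\<beta> * h + j)" "y = \<beta> * h + j" by auto
    have "\<beta> * h \<le> 2 * h" using b h by (intro mult_right_mono) auto
    then have "y < 3 * h" using b by linarith
    moreover have "0 \<le> \<beta> * h" using b h by simp
    then have "0 \<le> y" using b by linarith
    ultimately show "y \<in> {y \<in> {0..<3 * h}. P y}" using b by simp
  qed
  then have "card {y \<in> {0..<3 * h}. P y} = card ?S" using card_image[OF inj] by simp
  also have "\<dots> = (\<Sum>\<beta>\<in>{0..<3::int}. card {j \<in> {0..<h}. P (\<beta> * h + j)})"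
    by (intro card_SigmaI ballI finite_filter) auto
  finally show ?thesis .
qed

section \<open>Row and column counts of the block set\<close>

text \<open>An injection of a finite set into itself is a permutation, so every value below
  \<open>\<kappa>\<close> is taken exactly once.\<close>

lemma card_permutation_less:
  fixes h \<kappa> :: int
  assumes "inj_on f {0..<h}" "f ` {0..<h} \<subseteq> {0..<h}" "0 \<le> \<kappa>" "\<kappa> \<le> h"
  shows "card {i \<in> {0..<h}. f i < \<kappa>} = nat \<kappa>"
proof -
  have surj: "f ` {0..<h} = {0..<h}" using assms by (intro endo_inj_surj) auto
  have "f ` {i \<in> {0..<h}. f i < \<kappa>} = {0..<\<kappa>}"
  proof
    show "f ` {i \<in> {0..<h}. f i < \<kappa>} \<subseteq> {0..<\<kappa>}" using assms(2) by (auto simp: image_subset_iff)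
    show "{0..<\<kappa>} \<subseteq> f ` {i \<in> {0..<h}. f i < \<kappa>}"
    proof
      fix s assume s: "s \<in> {0..<\<kappa>}"
      then have "s \<in> f ` {0..<h}" using surj assms(4) by simp
      then show "s \<in> f ` {i \<in> {0..<h}. f i < \<kappa>}" using s by auto
    qed
  qed
  moreover have "inj_on f {i \<in> {0..<h}. f i < \<kappa>}"
    using assms(1) by (rule inj_on_subset) auto
  ultimately have "card {i \<in> {0..<h}. f i < \<kappa>} = card {0..<\<kappa>}" by (metis card_image)
  then show ?thesis by simp
qed

text \<open>Values of \<open>g\<close> differ by less than \<open>h\<close>, so congruent ones
  coincide. The sign \<open>s = 1\<close> serves the rows and \<open>s = -1\<close> the columns of
  the block set.\<close>

lemma inj_on_shift_mod:
  fixes h :: int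
  assumes "inj_on g {0..<h}" "g ` {0..<h} \<subseteq> {0..<h}" "s = 1 \<or> s = -1"
  shows "inj_on (\<lambda>i. (c + s * g i) mod h) {0..<h}"
proof (rule inj_onI)
  fix i j assume ij: "i \<in> {0..<h}" "j \<in> {0..<h}" and "(c + s * g i) mod h = (c + s * g j) mod h"
  then have "h dvd (c + s * g i) - (c + s * g j)" by (simp only: mod_eq_dvd_iff)
  then have "h dvd s * (g i - g j)" by (simp add: algebra_simps)
  then have "h dvd g i - g j" using assms(3) by (auto simp: dvd_diff_commute)
  moreover have "g i \<in> {0..<h}" "g j \<in> {0..<h}" using assms(2) ij by (auto simp: image_subset_iff)
  then have "\<bar>g i - g j\<bar> < h" by auto
  ultimately have "g i = g j" using dvd_imp_le_int[of "g i - g j" h] by force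
  then show "i = j" using assms(1) ij by (simp add: inj_on_def)
qed

text \<open>Division by \<open>q\<close> recovers both digits, \<open>i div m\<close> as remainder
  and \<open>i mod m\<close> as quotient, because \<open>i div m < q\<close>.\<close>

lemma transpose_digits:
  fixes q m :: int
  assumes "q > 0" "m > 0"
  shows "inj_on (\<lambda>i. q * (i mod m) + i div m) {0..<q * m}"
    and "(\<lambda>i. q * (i mod m) + i div m) ` {0..<q * m} \<subseteq> {0..<q * m}"
proof -
  have dig: "0 \<le> i mod m" "i mod m < m" "0 \<le> i div m" "i div m < q" if "i \<in> {0..<q * m}" for i
    using that assms by (auto simp: pos_imp_zdiv_nonneg_iff intro!: int_div_less)
  show "inj_on (\<lambda>i. q * (i mod m) + i div m) {0..<q * m}"
  proof (rule inj_onI)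
    fix i j assume i: "i \<in> {0..<q * m}" and j: "j \<in> {0..<q * m}"
      and eq: "q * (i mod m) + i div m = q * (j mod m) + j div m"
    have "(q * (i mod m) + i div m) mod q = i div m" "(q * (i mod m) + i div m) div q = i mod m"
      using dig[OF i] assms by simp_all
    moreover have "(q * (j mod m) + j div m) mod q = j div m" "(q * (j mod m) + j div m) div q = j mod m"
      using dig[OF j] assms by simp_all
    ultimately have "i div m = j div m" "i mod m = j mod m" using eq by metis+
    then show "i = j" by (metis div_mult_mod_eq)
  qed
  show "(\<lambda>i. q * (i mod m) + i div m) ` {0..<q * m} \<subseteq> {0..<q * m}"
  proof
    fix z assume "z \<in> (\<lambda>i. q * (i mod m) + i div m) ` {0..<q * m}"
    then obtain i where i: "i \<in> {0..<q * m}" "z = q * (i mod m) + i div m" by auto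
    have "q * (i mod m) \<le> q * (m - 1)" using dig[OF i(1)] assms by (intro mult_left_mono) auto
    then have "z < q * m" using i(2) dig[OF i(1)] by (simp add: algebra_simps)
    moreover have "0 \<le> q * (i mod m)" using dig[OF i(1)] assms by simp
    then have "0 \<le> z" using i(2) dig[OF i(1)] by linarith
    ultimately show "z \<in> {0..<q * m}" by simp
  qed
qed

text \<open>For fixed \<open>x\<close> the tested residue is a cyclic shift of the column's position
  in its block, so each block contributes exactly its window length.\<close>

lemma block_set_row:
  fixes q m :: int
  assumes q: "q > 0" and m: "m > 0"
    and K: "\<And>\<beta>. \<beta> \<in> {0..<3} \<Longrightarrow> 0 \<le> K (x div (q * m)) \<beta> \<and> K (x div (q * m)) \<beta> \<le> q * m"
    and x: "x \<in> {0..<3 * (q * m)}"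
  shows "card {y. (x, y) \<in> block_set q m K} = (\<Sum>\<beta>\<in>{0..<3}. nat (K (x div (q * m)) \<beta>))"
proof -
  define h where "h = q * m"
  have h: "h > 0" using q m by (simp add: h_def)
  define c where "c = - q * (x mod m) - x div m"
  have "{y. (x, y) \<in> block_set q m K}
      = {y \<in> {0..<3 * h}. (y - q * (x mod m) - x div m) mod h < K (x div h) (y div h)}"
    using x by (auto simp: block_set_def h_def)
  then have "card {y. (x, y) \<in> block_set q m K} = (\<Sum>\<beta>\<in>{0..<3}. card {j \<in> {0..<h}.
      (\<beta> * h + j - q * (x mod m) - x div m) mod h < K (x div h) ((\<beta> * h + j) div h)})"
    by (simp only: card_three_blocks[OF h])
  also have "\<dots> = (\<Sum>\<beta>\<in>{0..<3}. nat (K (x div h) \<beta>))"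
  proof (rule sum.cong[OF refl])
    fix \<beta> :: int assume \<beta>: "\<beta> \<in> {0..<3}"
    have "(\<beta> * h + j - q * (x mod m) - x div m) mod h = (c + 1 * j) mod h" for j
    proof -
      have "\<beta> * h + j - q * (x mod m) - x div m = (c + 1 * j) + \<beta> * h" by (simp add: c_def)
      then show ?thesis by (simp only: mod_mult_self1)
    qed
    moreover have "(\<beta> * h + j) div h = \<beta>" if "j \<in> {0..<h}" for j using that h by simp
    ultimately have "{j \<in> {0..<h}. (\<beta> * h + j - q * (x mod m) - x div m) mod h < K (x div h) ((\<beta> * h + j) div h)}
        = {j \<in> {0..<h}. (c + 1 * j) mod h < K (x div h) \<beta>}" by auto
    moreover have "card {j \<in> {0..<h}. (c + 1 * j) mod h < K (x div h) \<beta>} = nat (K (x div h) \<beta>)"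
    proof (rule card_permutation_less)
      show "inj_on (\<lambda>j. (c + 1 * j) mod h) {0..<h}" by (rule inj_on_shift_mod) auto
      show "(\<lambda>j. (c + 1 * j) mod h) ` {0..<h} \<subseteq> {0..<h}" using h by auto
    qed (use K[OF \<beta>] in \<open>simp_all add: h_def\<close>)
    ultimately show "card {j \<in> {0..<h}. (\<beta> * h + j - q * (x mod m) - x div m) mod h < K (x div h) ((\<beta> * h + j) div h)}
        = nat (K (x div h) \<beta>)" by simp
  qed
  finally show ?thesis by (simp add: h_def)
qed

text \<open>For fixed \<open>y\<close> the tested residue is a constant minus the transposed digits
  of the row's position in its block, again a permutation of the residues.\<close>

lemma block_set_column:
  fixes q m :: int
  assumes q: "q > 0" and m: "m > 0"
    and K: "\<And>\<alpha>. \<alpha> \<in> {0..<3} \<Longrightarrow> 0 \<le> K \<alpha> (y div (q * m)) \<and> K \<alpha> (y div (q * m)) \<le> q * m"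
    and y: "y \<in> {0..<3 * (q * m)}"
  shows "card {x. (x, y) \<in> block_set q m K} = (\<Sum>\<alpha>\<in>{0..<3}. nat (K \<alpha> (y div (q * m))))"
proof -
  define h where "h = q * m"
  have h: "h > 0" using q m by (simp add: h_def)
  define g where "g i = q * (i mod m) + i div m" for i
  have "{x. (x, y) \<in> block_set q m K}
      = {x \<in> {0..<3 * h}. (y - q * (x mod m) - x div m) mod h < K (x div h) (y div h)}"
    using y by (auto simp: block_set_def h_def)
  then have "card {x. (x, y) \<in> block_set q m K} = (\<Sum>\<alpha>\<in>{0..<3}. card {i \<in> {0..<h}.
      (y - q * ((\<alpha> * h + i) mod m) - (\<alpha> * h + i) div m) mod h < K ((\<alpha> * h + i) div h) (y div h)})"
    by (simp only: card_three_blocks[OF h])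
  also have "\<dots> = (\<Sum>\<alpha>\<in>{0..<3}. nat (K \<alpha> (y div h)))"
  proof (rule sum.cong[OF refl])
    fix \<alpha> :: int assume \<alpha>: "\<alpha> \<in> {0..<3}"
    \<comment> \<open>As \<open>h\<close> is a multiple of \<open>m\<close>, moving by
      \<open>\<alpha>\<close> blocks leaves the remainder modulo \<open>m\<close> unchanged and adds
      \<open>\<alpha> * q\<close> to the quotient, which is absorbed in the constant.\<close>
    have "\<alpha> * h + i = i + \<alpha> * q * m" for i by (simp add: h_def)
    then have "(\<alpha> * h + i) mod m = i mod m" "(\<alpha> * h + i) div m = \<alpha> * q + i div m" for i
      using m by (simp_all only: mod_mult_self1) simp
    then have e: "y - q * ((\<alpha> * h + i) mod m) - (\<alpha> * h + i) div m = (y - \<alpha> * q) + (-1) * g i" for i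
      by (simp add: g_def)
    have "(\<alpha> * h + i) div h = \<alpha>" if "i \<in> {0..<h}" for i using that h by simp
    then have "{i \<in> {0..<h}. (y - q * ((\<alpha> * h + i) mod m) - (\<alpha> * h + i) div m) mod h < K ((\<alpha> * h + i) div h) (y div h)}
        = {i \<in> {0..<h}. ((y - \<alpha> * q) + (-1) * g i) mod h < K \<alpha> (y div h)}" unfolding e by auto
    moreover have "card {i \<in> {0..<h}. ((y - \<alpha> * q) + (-1) * g i) mod h < K \<alpha> (y div h)} = nat (K \<alpha> (y div h))"
    proof (rule card_permutation_less)
      show "inj_on (\<lambda>i. ((y - \<alpha> * q) + (-1) * g i) mod h) {0..<h}"
        by (rule inj_on_shift_mod) (use transpose_digits[OF q m] in \<open>simp_all add: g_def[abs_def] h_def\<close>)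
      show "(\<lambda>i. ((y - \<alpha> * q) + (-1) * g i) mod h) ` {0..<h} \<subseteq> {0..<h}" using h by auto
    qed (use K[OF \<alpha>] in \<open>simp_all add: h_def\<close>)
    ultimately show "card {i \<in> {0..<h}. (y - q * ((\<alpha> * h + i) mod m) - (\<alpha> * h + i) div m) mod h < K ((\<alpha> * h + i) div h) (y div h)}
        = nat (K \<alpha> (y div h))" by simp
  qed
  finally show ?thesis by (simp add: h_def)
qed

section \<open>Lines of nonzero finite slope in the block set\<close>

text \<open>All window lengths are replaced by their upper bound \<open>b\<close>, about
  \<open>2 * k / 5\<close>. The main terms are then about \<open>3 / 2 * b\<close> for
  \<open>|v| \<le> u\<close> and at most about \<open>5 / 3 * b\<close> for
  \<open>u < |v| \<le> q / 10\<close>, that is \<open>3 * k / 5\<close> and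
  \<open>2 * k / 3\<close>. The remaining terms are of order \<open>q\<close> or tiny fractions of
  \<open>k\<close>, and \<open>1000 * q \<le> k\<close> absorbs them.\<close>

lemma block_set_steep_line:
  fixes q m k u v x0 y0 :: int and b :: int
  assumes q: "q \<ge> 1000" and m: "0 < m" "m \<le> q" and k: "1000 * q \<le> k"
    and b: "0 \<le> b" "b \<le> q * m" "5 * b \<le> 2 * k + 10"
    and K: "\<And>\<alpha> \<beta>. \<alpha> \<in> {0..<3} \<Longrightarrow> \<beta> \<in> {0..<3} \<Longrightarrow> K \<alpha> \<beta> \<le> b"
    and u: "u > 0" and v: "v \<noteq> 0" and M: "u \<ge> 2 \<or> \<bar>v\<bar> \<ge> 2"
  shows "real (card {t. (x0 + t * u, y0 + t * v) \<in> block_set q m K}) \<le> 9 / 10 * k"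
proof -
  define h where "h = q * m"
  have h: "h > 0" using q m by (simp add: h_def)
  define H where "H = {t. (x0 + t * u, y0 + t * v) \<in> block_set q m K}"
  have "block_set q m K \<subseteq> {0..<3 * h} \<times> {0..<3 * h}" by (auto simp: block_set_def h_def)
  then have "finite (block_set q m K)" by (rule finite_subset) simp
  then have fin: "finite H" unfolding H_def using u by (intro finite_line_params) auto
  have box: "0 \<le> x0 + t * u" "x0 + t * u < 3 * h" "0 \<le> y0 + t * v" "y0 + t * v < 3 * h" if "t \<in> H" for t
    using that by (auto simp: H_def block_set_def h_def)
  have hit: "(y0 + t * v - q * ((x0 + t * u) mod m) - (x0 + t * u) div m) mod (q * m) < b" if "t \<in> H" for t
  proof -
    have "(x0 + t * u) div h < 3" "(y0 + t * v) div h < 3" using box[OF that] h by (auto intro!: int_div_less)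
    moreover have "(x0 + t * u) div h \<ge> 0" "(y0 + t * v) div h \<ge> 0"
      using box[OF that] h by (simp_all add: pos_imp_zdiv_nonneg_iff)
    ultimately have "K ((x0 + t * u) div h) ((y0 + t * v) div h) \<le> b" by (intro K) auto
    then show ?thesis using that by (auto simp: H_def block_set_def h_def)
  qed
  have rk: "1000 * real_of_int q \<le> k" "real_of_int q \<ge> 1000" "0 < real_of_int m" "real_of_int m \<le> q"
    "0 \<le> real_of_int b" "5 * real_of_int b \<le> 2 * real_of_int k + 10" "real_of_int u > 0"
    using q m k b u by linarith+
  have "real (card H) \<le> 9 / 10 * k"
  proof (cases "H = {}")
    case True
    then show ?thesis using rk by simp
  next
    case False
    define t1 t2 where "t1 = Min H" and "t2 = Max H"
    have t1: "t1 \<in> H" and t2: "t2 \<in> H" using Min_in[OF fin False] Max_in[OF fin False]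
      by (simp_all add: t1_def t2_def)
    have t12: "t1 \<le> t2" using Min_le[OF fin t2] by (simp add: t1_def)
    have sub: "H \<subseteq> {t1..t2}" using fin by (auto simp: t1_def t2_def)
    have spanu: "(t2 - t1) * u < 3 * h" using box(1)[OF t1] box(2)[OF t2] by (simp add: algebra_simps)
    have spanv: "(t2 - t1) * \<bar>v\<bar> < 3 * h"
      using box(3,4)[OF t1] box(3,4)[OF t2] by (cases "v \<ge> 0") (simp_all add: algebra_simps)
    have cardH: "card H \<le> nat (t2 - t1 + 1)"
      using card_mono[OF _ sub] by simp
    have strip: "real (card H) \<le> (real_of_int ((t2 - t1) * u) / m + 2) *
       ((b + real_of_int m * \<bar>v\<bar> / u) / real_of_int (q * u - v) + 4)" if "v < q * u"
    proof -
      have "H \<subseteq> {t \<in> {t1..t2}. (y0 + t * v - q * ((x0 + t * u) mod m) - (x0 + t * u) div m) mod (q * m) < b}"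
        using sub hit by blast
      then have "card H \<le> card {t \<in> {t1..t2}. (y0 + t * v - q * ((x0 + t * u) mod m) - (x0 + t * u) div m) mod (q * m) < b}"
        by (rule card_mono[rotated]) (rule finite_filter, simp)
      also have "real \<dots> \<le> (real_of_int ((t2 - t1) * u) / m + 2) *
         ((b + real_of_int m * \<bar>v\<bar> / u) / real_of_int (q * u - v) + 4)"
        by (rule card_strip) (use q m u b t12 that in auto)
      finally show ?thesis by simp
    qed
    define X where "X = real_of_int ((t2 - t1) * u) / m"
    define s where "s = real_of_int \<bar>v\<bar>"
    have s1: "s \<ge> 1" using v by (simp add: s_def)
    have X0: "X \<ge> 0" using t12 u m by (simp add: X_def)
    have u1: "real_of_int u \<ge> 1" using u by simp
    consider "\<bar>v\<bar> \<le> u" | "u < \<bar>v\<bar>" "10 * \<bar>v\<bar> \<le> q" | "q < 10 * \<bar>v\<bar>" by linarith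
    then show ?thesis
    proof cases
      case 1
      have u2: "u \<ge> 2" using M 1 by linarith
      have "real_of_int ((t2 - t1) * u) \<le> real_of_int (3 * (q * m))"
        using spanu by (simp only: of_int_le_iff h_def)
      then have X: "X \<le> 3 * q" using rk by (simp add: X_def pos_divide_le_eq)
      have "q * u - v \<ge> q * u - u" using 1 by linarith
      moreover have "(q - 1) * u \<ge> (q - 1) * 2" using u2 q by (intro mult_left_mono) auto
      ultimately have d: "2 * (q - 1) \<le> q * u - v" by (simp add: algebra_simps)
      moreover have "0 < 2 * (q - 1)" using q by simp
      ultimately have "0 < q * u - v" by (rule less_le_trans[rotated])
      then have vd: "v < q * u" by simp
      \<comment> \<open>Since \<open>q \<ge> 1000\<close>,
        \<open>2 * (q - 1) \<ge> 999 / 500 * q\<close>; likewise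
        \<open>3 * q + 2 \<le> 1501 / 500 * q\<close> below. A step of about \<open>2 * q\<close> or
        more halves the count per group.\<close>
      have dr: "real_of_int (q * u - v) \<ge> 999 / 500 * q"
      proof -
        have "real_of_int (q * u - v) \<ge> real_of_int (2 * (q - 1))" using d by (simp only: of_int_le_iff)
        then show ?thesis using rk by simp
      qed
      have "s / u \<le> 1" using 1 u by (simp add: s_def)
      then have "real_of_int m * (s / u) \<le> real_of_int m * 1" using rk by (intro mult_left_mono) auto
      then have ms: "real_of_int m * s / u \<le> m" by simp
      have "(b + real_of_int m * s / u) / real_of_int (q * u - v) \<le> (b + m) / (999 / 500 * q)"
        using ms dr rk s1 by (intro frac_le) auto
      then have "(X + 2) * ((b + real_of_int m * s / u) / real_of_int (q * u - v) + 4)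
          \<le> (3 * q + 2) * ((b + m) / (999 / 500 * q) + 4)"
        using X X0 rk s1 dr by (intro mult_mono add_mono) (auto intro!: add_nonneg_nonneg divide_nonneg_nonneg)
      also have "\<dots> \<le> (1501 / 500 * q) * ((b + m) / (999 / 500 * q) + 4)"
        using rk by (intro mult_right_mono) (auto intro!: add_nonneg_nonneg divide_nonneg_nonneg)
      also have "\<dots> = 1501 / 999 * (b + m) + 1501 / 125 * q" using rk by (simp add: field_simps)
      also have "\<dots> \<le> 9 / 10 * k" using rk unfolding of_int_add distrib_left by linarith
      finally show ?thesis by (rule order_trans[OF strip[OF vd, folded X_def s_def]])
    next
      case 2
      have s2: "s \<ge> 2" and us: "real_of_int u \<le> s" and sq: "10 * s \<le> q" using M 2 u by (simp_all add: s_def)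
      have "v \<le> \<bar>v\<bar>" "q * 1 \<le> q * u" using q u by (simp, intro mult_left_mono) auto
      then have vd: "v < q * u" using 2 q v by linarith
      have qu: "real_of_int q \<le> real_of_int q * u" using rk u1 by simp
      have "real_of_int v \<le> s" by (simp add: s_def)
      \<comment> \<open>\<open>|v| \<le> q / 10 \<le> q * u / 10\<close> keeps the step
        \<open>q * u - v\<close> above nine tenths of \<open>q * u\<close>, while the span of the
        second coordinate limits the number of groups to about \<open>3 * q * u / s\<close>.\<close>
      then have dr: "real_of_int (q * u - v) \<ge> 9 / 10 * (real_of_int q * u)" using sq qu by simp
      have "real_of_int ((t2 - t1) * \<bar>v\<bar>) \<le> real_of_int (3 * (q * m))"
        using spanv by (simp only: of_int_le_iff h_def)
      then have "real_of_int (t2 - t1) * s \<le> 3 * q * m" by (simp add: s_def)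
      then have "real_of_int (t2 - t1) \<le> 3 * q * m / s" using s1 by (simp add: pos_le_divide_eq)
      then have "X \<le> (3 * q * m / s) * u / m" unfolding X_def of_int_mult
        using rk by (intro divide_right_mono mult_right_mono) auto
      then have X: "X \<le> 3 * q * u / s" using rk by simp
      have dpos: "0 < real_of_int (q * u - v)" using vd by (simp only: of_int_0_less_iff)
      have "(b + real_of_int m * s / u) / real_of_int (q * u - v) \<le> (b + real_of_int m * s / u) / (9 / 10 * (real_of_int q * u))"
        using dr rk s1 u1 by (intro divide_left_mono) (auto intro!: mult_pos_pos dpos add_nonneg_nonneg divide_nonneg_nonneg simp del: of_int_mult of_int_diff)
      then have "(X + 2) * ((b + real_of_int m * s / u) / real_of_int (q * u - v) + 4)
          \<le> (3 * q * u / s + 2) * ((b + real_of_int m * s / u) / (9 / 10 * (real_of_int q * u)) + 4)"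
        using X X0 rk s1 dpos by (intro mult_mono add_mono) (auto intro!: add_nonneg_nonneg divide_nonneg_nonneg simp del: of_int_mult of_int_diff)
      also have "\<dots> = 10 / 3 * (b / s) + 10 / 3 * (m / u) + 12 * real_of_int q * (u / s)
          + 20 / 9 * (b / (real_of_int q * u)) + 20 / 9 * (m / real_of_int u * (s / (real_of_int q * u))) + 8"
        using rk s1 by (simp add: field_simps)
      also have "\<dots> \<le> 10 / 3 * (b / 2) + 10 / 3 * m + 12 * real_of_int q * 1 + 20 / 9 * (b / 1000) + 20 / 9 * (real_of_int m * 1) + 8"
      proof (intro add_mono mult_left_mono order.refl)
        show "real_of_int b / s \<le> b / 2" using rk s2 by (intro divide_left_mono) auto
        show "real_of_int m / u \<le> m" using rk u1 by (simp add: pos_divide_le_eq mult_le_cancel_left1)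
        show "real_of_int u / s \<le> 1" using us s1 by simp
        have "1000 \<le> real_of_int q * u" using qu rk by linarith
        then show "real_of_int b / (real_of_int q * u) \<le> b / 1000"
          by (rule divide_left_mono) (use rk in auto)
        have "s \<le> real_of_int q * u" using qu sq s1 by linarith
        then have "s / (real_of_int q * u) \<le> 1" using rk by simp
        moreover have "real_of_int m / u \<le> m" using rk u1 by (simp add: pos_divide_le_eq mult_le_cancel_left1)
        ultimately show "real_of_int m / u * (s / (real_of_int q * u)) \<le> real_of_int m * 1"
          using rk s1 by (intro mult_mono) auto
      qed (use rk in auto)
      also have "\<dots> \<le> 9 / 10 * k" using rk unfolding of_int_add distrib_left by linarith
      finally show ?thesis by (rule order_trans[OF strip[OF vd, folded X_def s_def]])
    next
      case 3
      \<comment> \<open>So steep a line has at most \<open>30 * m\<close> parameters in the range,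
        and \<open>30 * m \<le> 30 * q\<close> is far below \<open>k\<close>.\<close>
      have "(t2 - t1) * q \<le> (t2 - t1) * (10 * \<bar>v\<bar>)" using 3 t12 by (intro mult_left_mono) auto
      also have "\<dots> < 30 * m * q" using spanv by (simp add: h_def algebra_simps)
      finally have "t2 - t1 < 30 * m" using q by simp
      then have "real (card H) \<le> 30 * real_of_int m" using cardH t12 by linarith
      then show ?thesis using rk by linarith
    qed
  qed
  then show ?thesis by (simp add: H_def)
qed

text \<open>With \<open>a, b, e\<close> near \<open>3k/10, 2k/5, k/5\<close> the row and column sums \<open>2a + b\<close> and \<open>2b + e\<close> equal \<open>k\<close>,
  whereas the wrapped diagonals \<open>2a + e\<close> and \<open>2b\<close> are only about \<open>4k/5\<close>.\<close>

definition block_density :: "int \<Rightarrow> int \<Rightarrow> int \<Rightarrow> int \<Rightarrow> int \<Rightarrow> int" where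
  "block_density a b e \<alpha> \<beta> = (if \<alpha> = 1 \<and> \<beta> = 1 then e else if \<alpha> = 1 \<or> \<beta> = 1 then b else a)"

text \<open>For fixed \<open>\<sigma>\<close> the blocks counted lie on one diagonal or antidiagonal
  of the three by three array: the main one sums to \<open>2 * a + e\<close>, its neighbours to
  \<open>2 * b\<close>, the corners to \<open>a \<le> 2 * a + e\<close>.\<close>

lemma block_density_diagonal:
  assumes "0 \<le> a" "0 \<le> b" "0 \<le> e" "2 * a + e \<le> M" "2 * b \<le> M" "v = 1 \<or> v = -1"
  shows "(\<Sum>\<alpha>\<in>{0..<3}. \<Sum>\<beta>\<in>{0..<3}. of_bool (\<sigma> + v * \<alpha> = \<beta>) * block_density a b e \<alpha> \<beta>) \<le> M"
proof -
  have three: "{0..<3::int} = {0, 1, 2}" by auto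
  consider "\<sigma> < -2" | "\<sigma> = -2" | "\<sigma> = -1" | "\<sigma> = 0" | "\<sigma> = 1" | "\<sigma> = 2" | "\<sigma> = 3" | "\<sigma> = 4" | "\<sigma> > 4"
    by linarith
  then show ?thesis
    by cases (use assms in \<open>auto simp: three block_density_def\<close>)
qed

text \<open>The line is cut at the block boundaries and the strip bound is applied in each block.
  The main terms form a weighted sum of the window lengths; averaging over the position within a
  block row reduces it to sums along block diagonals, at most about
  \<open>4 * k / 5\<close>.\<close>

lemma block_set_diagonal:
  fixes q m k v x0 y0 a b e :: int
  assumes q: "q \<ge> 1000" and m: "0 < m" "m \<le> q" and k: "1000 * q \<le> k"
    and abe: "0 \<le> a" "a \<le> q * m" "0 \<le> b" "b \<le> q * m" "0 \<le> e" "e \<le> q * m"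
    and sum: "2 * a + b = k" "2 * b + e = k"
    and M: "5 * (2 * a + e) \<le> 4 * k + 20" "5 * (2 * b) \<le> 4 * k + 20"
    and v: "v = 1 \<or> v = -1"
  shows "real (card {t. (x0 + t * 1, y0 + t * v) \<in> block_set q m (block_density a b e)}) \<le> 9 / 10 * k"
proof -
  define h where "h = q * m"
  have h: "h > 0" using q m by (simp add: h_def)
  define K where "K = block_density a b e"
  \<comment> \<open>The line becomes \<open>y = y1 + v * x\<close>, parametrised by the row.\<close>
  define y1 where "y1 = y0 - v * x0"
  define hit where "hit x \<kappa> \<longleftrightarrow> (y1 + v * x - q * (x mod m) - x div m) mod h < \<kappa>" for x \<kappa>
  have K: "0 \<le> K \<alpha> \<beta>" "K \<alpha> \<beta> \<le> q * m" for \<alpha> \<beta>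
    using abe by (auto simp: K_def block_density_def)
  \<comment> \<open>\<open>G \<alpha> \<beta>\<close> collects the positions in block row
    \<open>\<alpha>\<close> at which the line runs through block column
    \<open>\<beta>\<close>.\<close>
  define G where "G \<alpha> \<beta> = {i \<in> {0..<h}. (y1 + v * (\<alpha> * h + i)) div h = \<beta>}" for \<alpha> \<beta>
  have finG: "finite (G \<alpha> \<beta>)" for \<alpha> \<beta> unfolding G_def by (rule finite_filter) simp
  define B where "B \<alpha> \<beta> = {i \<in> G \<alpha> \<beta>. hit (\<alpha> * h + i) (K \<alpha> \<beta>)}" for \<alpha> \<beta>
  have finB: "finite (B \<alpha> \<beta>)" for \<alpha> \<beta> unfolding B_def by (rule finite_filter) (rule finG)
  let ?Q = "\<lambda>x. y1 + v * x \<in> {0..<3 * h} \<and> hit x (K (x div h) ((y1 + v * x) div h))"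
  have "{t. (x0 + t * 1, y0 + t * v) \<in> block_set q m K} = (\<lambda>x. x - x0) ` {x \<in> {0..<3 * h}. ?Q x}"
  proof (intro equalityI subsetI)
    fix t assume t: "t \<in> {t. (x0 + t * 1, y0 + t * v) \<in> block_set q m K}"
    have "y1 + v * (x0 + t) = y0 + t * v" by (simp add: y1_def algebra_simps)
    then have "x0 + t \<in> {x \<in> {0..<3 * h}. ?Q x}"
      using t by (simp add: block_set_def hit_def h_def)
    then show "t \<in> (\<lambda>x. x - x0) ` {x \<in> {0..<3 * h}. ?Q x}" by (rule rev_image_eqI) simp
  next
    fix t assume "t \<in> (\<lambda>x. x - x0) ` {x \<in> {0..<3 * h}. ?Q x}"
    then have x: "x0 + t \<in> {x \<in> {0..<3 * h}. ?Q x}" by auto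
    have "y1 + v * (x0 + t) = y0 + t * v" by (simp add: y1_def algebra_simps)
    then show "t \<in> {t. (x0 + t * 1, y0 + t * v) \<in> block_set q m K}"
      using x by (simp add: block_set_def hit_def h_def)
  qed
  then have "card {t. (x0 + t * 1, y0 + t * v) \<in> block_set q m K} = card {x \<in> {0..<3 * h}. ?Q x}"
    by (simp add: card_image inj_on_def)
  also have "\<dots> = (\<Sum>\<alpha>\<in>{0..<3}. card {i \<in> {0..<h}. ?Q (\<alpha> * h + i)})"
    by (rule card_three_blocks[OF h])
  also have "\<dots> \<le> (\<Sum>\<alpha>\<in>{0..<3}. \<Sum>\<beta>\<in>{0..<3}. card (B \<alpha> \<beta>))"
  proof (rule sum_mono)
    fix \<alpha> :: int
    have "{i \<in> {0..<h}. ?Q (\<alpha> * h + i)} \<subseteq> (\<Union>\<beta>\<in>{0..<3}. B \<alpha> \<beta>)"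
    proof
      fix i assume i: "i \<in> {i \<in> {0..<h}. ?Q (\<alpha> * h + i)}"
      define \<beta> where "\<beta> = (y1 + v * (\<alpha> * h + i)) div h"
      have "(\<alpha> * h + i) div h = \<alpha>" using i h by simp
      then have "i \<in> B \<alpha> \<beta>" using i by (simp add: B_def G_def \<beta>_def)
      moreover have "\<beta> \<in> {0..<3}" unfolding \<beta>_def using i h
        by (auto simp: pos_imp_zdiv_nonneg_iff intro!: int_div_less)
      ultimately show "i \<in> (\<Union>\<beta>\<in>{0..<3}. B \<alpha> \<beta>)" by blast
    qed
    then have "card {i \<in> {0..<h}. ?Q (\<alpha> * h + i)} \<le> card (\<Union>\<beta>\<in>{0..<3}. B \<alpha> \<beta>)"
      by (rule card_mono[rotated]) (use finB in auto)
    also have "\<dots> \<le> (\<Sum>\<beta>\<in>{0..<3}. card (B \<alpha> \<beta>))" by (rule card_UN_le) simp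
    finally show "card {i \<in> {0..<h}. ?Q (\<alpha> * h + i)} \<le> (\<Sum>\<beta>\<in>{0..<3}. card (B \<alpha> \<beta>))" .
  qed
  finally have le1: "real (card {t. (x0 + t * 1, y0 + t * v) \<in> block_set q m K})
      \<le> (\<Sum>\<alpha>\<in>{0..<3}. \<Sum>\<beta>\<in>{0..<3}. real (card (B \<alpha> \<beta>)))"
    by (simp only: of_nat_sum[symmetric] of_nat_le_iff)
  have rk: "1000 * real_of_int q \<le> k" "real_of_int q \<ge> 1000" "0 < real_of_int m" "real_of_int m \<le> q"
    using q m k by linarith+
  define l where "l \<alpha> \<beta> = real (card (G \<alpha> \<beta>))" for \<alpha> \<beta>
  \<comment> \<open>\<open>D\<close> is the smaller of the two possible steps \<open>q - 1\<close>
    and \<open>q + 1\<close>.\<close>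
  define D where "D = real_of_int q - 1"
  have D: "D \<ge> 999" "real_of_int q = D + 1" using rk by (simp_all add: D_def)
  have block: "real (card (B \<alpha> \<beta>)) \<le> (l \<alpha> \<beta> / m + 2) * ((K \<alpha> \<beta> + m) / D + 4)" for \<alpha> \<beta>
  proof (cases "G \<alpha> \<beta> = {}")
    case True
    then have "card (B \<alpha> \<beta>) = 0" by (simp add: B_def)
    moreover have "0 \<le> (l \<alpha> \<beta> / m + 2) * ((K \<alpha> \<beta> + m) / D + 4)"
      using K rk D by (auto simp: l_def intro!: mult_nonneg_nonneg add_nonneg_nonneg divide_nonneg_nonneg)
    ultimately show ?thesis by simp
  next
    case False
    define t1 t2 where "t1 = Min (G \<alpha> \<beta>)" and "t2 = Max (G \<alpha> \<beta>)"
    have t1: "t1 \<in> G \<alpha> \<beta>" and t2: "t2 \<in> G \<alpha> \<beta>" using Min_in[OF finG False] Max_in[OF finG False]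
      by (simp_all add: t1_def t2_def)
    have t12: "t1 \<le> t2" using Min_le[OF finG t2] by (simp add: t1_def)
    have sub: "G \<alpha> \<beta> \<subseteq> {t1..t2}" using finG by (auto simp: t1_def t2_def)
    \<comment> \<open>The second coordinate is monotone along the line, so
      \<open>G \<alpha> \<beta>\<close> is an interval and its size exceeds
      \<open>t2 - t1\<close>.\<close>
    have "{t1..t2} \<subseteq> G \<alpha> \<beta>"
    proof
      fix i assume i: "i \<in> {t1..t2}"
      let ?y = "\<lambda>i. (y1 + v * (\<alpha> * h + i)) div h"
      have "?y t1 = \<beta>" "?y t2 = \<beta>" using t1 t2 by (auto simp: G_def)
      moreover have "?y t1 \<le> ?y i \<and> ?y i \<le> ?y t2 \<or> ?y t2 \<le> ?y i \<and> ?y i \<le> ?y t1"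
        using v i h by (auto intro!: zdiv_mono1)
      ultimately have "?y i = \<beta>" by auto
      then show "i \<in> G \<alpha> \<beta>" using i t1 t2 by (auto simp: G_def)
    qed
    then have "card {t1..t2} \<le> card (G \<alpha> \<beta>)" using finG by (intro card_mono) auto
    then have lt: "real_of_int ((t2 - t1) * 1) \<le> l \<alpha> \<beta>" using t12 by (simp add: l_def)
    have "y1 + v * (\<alpha> * h + i) - q * ((\<alpha> * h + i) mod m) - (\<alpha> * h + i) div m
        = y1 + v * (\<alpha> * h) + i * v - q * ((\<alpha> * h + i * 1) mod m) - (\<alpha> * h + i * 1) div m" for i
      by (simp add: distrib_left)
    then have "B \<alpha> \<beta> \<subseteq> {i \<in> {t1..t2}. (y1 + v * (\<alpha> * h) + i * v - q * ((\<alpha> * h + i * 1) mod m) - (\<alpha> * h + i * 1) div m) mod (q * m) < K \<alpha> \<beta>}"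
      using sub unfolding B_def hit_def h_def by (auto simp: add.assoc)
    then have "card (B \<alpha> \<beta>) \<le> card {i \<in> {t1..t2}. (y1 + v * (\<alpha> * h) + i * v - q * ((\<alpha> * h + i * 1) mod m) - (\<alpha> * h + i * 1) div m) mod (q * m) < K \<alpha> \<beta>}"
      by (rule card_mono[rotated]) (rule finite_filter, simp)
    also have "real \<dots> \<le> (real_of_int ((t2 - t1) * 1) / m + 2) *
         ((K \<alpha> \<beta> + real_of_int m * \<bar>v\<bar> / real_of_int 1) / real_of_int (q * 1 - v) + 4)"
      by (rule card_strip) (use q m v K t12 in auto)
    also have "\<dots> \<le> (l \<alpha> \<beta> / m + 2) * ((K \<alpha> \<beta> + m) / D + 4)"
    proof (rule mult_mono)
      have "(K \<alpha> \<beta> + real_of_int m * \<bar>v\<bar> / real_of_int 1) = real_of_int (K \<alpha> \<beta>) + m" using v by auto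
      moreover have "D \<le> real_of_int (q * 1 - v)" using v D by auto
      ultimately show "(K \<alpha> \<beta> + real_of_int m * \<bar>v\<bar> / real_of_int 1) / real_of_int (q * 1 - v) + 4
          \<le> (K \<alpha> \<beta> + m) / D + 4"
        using K[of \<alpha> \<beta>] rk D by (auto intro!: divide_left_mono mult_pos_pos)
      show "0 \<le> (K \<alpha> \<beta> + real_of_int m * \<bar>v\<bar> / real_of_int 1) / real_of_int (q * 1 - v) + 4"
        using K[of \<alpha> \<beta>] rk v by (auto intro!: add_nonneg_nonneg divide_nonneg_nonneg)
    qed (use lt rk in \<open>auto simp: l_def intro!: divide_right_mono\<close>)
    finally show ?thesis by simp
  qed
  have suml: "(\<Sum>\<beta>\<in>{0..<3}. l \<alpha> \<beta>) \<le> h" for \<alpha>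
  proof -
    have "(\<Sum>\<beta>\<in>{0..<3}. card (G \<alpha> \<beta>)) = card (\<Union>\<beta>\<in>{0..<3}. G \<alpha> \<beta>)"
      by (rule card_UN_disjoint[symmetric]) (use finG in \<open>auto simp: G_def\<close>)
    also have "\<dots> \<le> card {0..<h}" by (rule card_mono) (auto simp: G_def)
    finally have "real (\<Sum>\<beta>\<in>{0..<3}. card (G \<alpha> \<beta>)) \<le> real (nat h)"
      by (simp only: of_nat_le_iff card_atLeastLessThan_int diff_zero)
    moreover have "real (\<Sum>\<beta>\<in>{0..<3}. card (G \<alpha> \<beta>)) = (\<Sum>\<beta>\<in>{0..<3}. l \<alpha> \<beta>)"
      unfolding l_def by (rule of_nat_sum)
    ultimately show ?thesis using h by simp
  qed
  \<comment> \<open>The rows \<open>\<alpha> * h + i\<close> with the same \<open>i\<close> meet the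
    line in blocks of a single block diagonal, with offset \<open>(y1 + v * i) div h\<close>.
    Exchanging the sums bounds the total by \<open>h\<close> times the largest diagonal sum.\<close>
  have "(\<Sum>\<alpha>\<in>{0..<3}. \<Sum>\<beta>\<in>{0..<3}. int (card (G \<alpha> \<beta>)) * K \<alpha> \<beta>)
      = (\<Sum>\<alpha>\<in>{0..<3}. \<Sum>\<beta>\<in>{0..<3}. \<Sum>i\<in>{0..<h}. of_bool ((y1 + v * i) div h + v * \<alpha> = \<beta>) * K \<alpha> \<beta>)"
  proof (intro sum.cong refl)
    fix \<alpha> \<beta> :: int
    have "(y1 + v * (\<alpha> * h + i)) div h = (y1 + v * i) div h + v * \<alpha>" for i
    proof -
      have eq: "y1 + v * (\<alpha> * h + i) = (y1 + v * i) + (v * \<alpha>) * h" by (simp add: algebra_simps)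
      have "(y1 + v * (\<alpha> * h + i)) div h = v * \<alpha> + (y1 + v * i) div h"
        unfolding eq by (rule div_mult_self1) (use h in simp)
      then show ?thesis by simp
    qed
    then have "G \<alpha> \<beta> = {i \<in> {0..<h}. (y1 + v * i) div h + v * \<alpha> = \<beta>}" by (simp add: G_def)
    then have "int (card (G \<alpha> \<beta>)) = (\<Sum>i\<in>{0..<h}. of_bool ((y1 + v * i) div h + v * \<alpha> = \<beta>))"
      by (simp add: Int_def)
    then show "int (card (G \<alpha> \<beta>)) * K \<alpha> \<beta> = (\<Sum>i\<in>{0..<h}. of_bool ((y1 + v * i) div h + v * \<alpha> = \<beta>) * K \<alpha> \<beta>)"
      by (simp add: sum_distrib_right)
  qed
  also have "\<dots> = (\<Sum>\<alpha>\<in>{0..<3}. \<Sum>i\<in>{0..<h}. \<Sum>\<beta>\<in>{0..<3}. of_bool ((y1 + v * i) div h + v * \<alpha> = \<beta>) * K \<alpha> \<beta>)"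
    by (rule sum.cong[OF refl], rule sum.swap)
  also have "\<dots> = (\<Sum>i\<in>{0..<h}. \<Sum>\<alpha>\<in>{0..<3}. \<Sum>\<beta>\<in>{0..<3}. of_bool ((y1 + v * i) div h + v * \<alpha> = \<beta>) * K \<alpha> \<beta>)"
    by (rule sum.swap)
  also have "\<dots> \<le> (\<Sum>i\<in>{0..<h}. max (2 * a + e) (2 * b))"
    unfolding K_def by (intro sum_mono block_density_diagonal) (use abe v in auto)
  also have "\<dots> = h * max (2 * a + e) (2 * b)" using h by simp
  also have "5 * \<dots> \<le> h * (4 * k + 20)"
  proof -
    have "5 * max (2 * a + e) (2 * b) \<le> 4 * k + 20" using M by (auto simp: max_def)
    then have "h * (5 * max (2 * a + e) (2 * b)) \<le> h * (4 * k + 20)" using h by (intro mult_left_mono) auto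
    then show ?thesis by simp
  qed
  finally have "5 * (\<Sum>\<alpha>\<in>{0..<3}. \<Sum>\<beta>\<in>{0..<3}. int (card (G \<alpha> \<beta>)) * K \<alpha> \<beta>) \<le> h * (4 * k + 20)" by simp
  then have "real_of_int (5 * (\<Sum>\<alpha>\<in>{0..<3}. \<Sum>\<beta>\<in>{0..<3}. int (card (G \<alpha> \<beta>)) * K \<alpha> \<beta>)) \<le> real_of_int (h * (4 * k + 20))"
    by (simp only: of_int_le_iff)
  then have sumlK: "(\<Sum>\<alpha>\<in>{0..<3}. \<Sum>\<beta>\<in>{0..<3}. l \<alpha> \<beta> * K \<alpha> \<beta>) \<le> h * (4 / 5 * k + 4)"
    by (simp add: l_def algebra_simps)
  have sumK: "(\<Sum>\<alpha>\<in>{0..<3}. \<Sum>\<beta>\<in>{0..<3}. real_of_int (K \<alpha> \<beta>)) = 3 * k"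
  proof -
    have "{0..<3::int} = {0, 1, 2}" by auto
    then have "(\<Sum>\<alpha>\<in>{0..<3}. \<Sum>\<beta>\<in>{0..<3}. K \<alpha> \<beta>) = 3 * k"
      using sum by (simp add: K_def block_density_def)
    then show ?thesis by (metis (mono_tags, lifting) of_int_mult of_int_numeral of_int_sum sum.cong)
  qed
  have suml3: "(\<Sum>\<alpha>\<in>{0..<3}. \<Sum>\<beta>\<in>{0..<3}. l \<alpha> \<beta>) \<le> 3 * h"
    using sum_mono[of "{0..<3::int}" "\<lambda>\<alpha>. \<Sum>\<beta>\<in>{0..<3}. l \<alpha> \<beta>" "\<lambda>_. real_of_int h"] suml by simp
  have "(\<Sum>\<alpha>\<in>{0..<3}. \<Sum>\<beta>\<in>{0..<3}. real (card (B \<alpha> \<beta>)))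
     \<le> (\<Sum>\<alpha>\<in>{0..<3}. \<Sum>\<beta>\<in>{0..<3}. (l \<alpha> \<beta> / m + 2) * ((K \<alpha> \<beta> + m) / D + 4))"
    by (intro sum_mono block)
  \<comment> \<open>The first term of the expansion carries the density bound. As
    \<open>h = q * m\<close>, its factor \<open>h / (m * D)\<close> is
    \<open>(D + 1) / D \<le> 1000 / 999\<close>.\<close>
  also have "\<dots> = (\<Sum>\<alpha>\<in>{0..<3::int}. \<Sum>\<beta>\<in>{0..<3::int}. 1 / (m * D) * (l \<alpha> \<beta> * K \<alpha> \<beta>)
      + (1 / D + 4 / m) * l \<alpha> \<beta> + 2 / D * K \<alpha> \<beta> + (2 * m / D + 8))"
    by (intro sum.cong refl) (use rk D in \<open>simp add: field_simps\<close>)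
  also have "\<dots> = 1 / (m * D) * (\<Sum>\<alpha>\<in>{0..<3::int}. \<Sum>\<beta>\<in>{0..<3::int}. l \<alpha> \<beta> * K \<alpha> \<beta>)
      + (1 / D + 4 / m) * (\<Sum>\<alpha>\<in>{0..<3::int}. \<Sum>\<beta>\<in>{0..<3::int}. l \<alpha> \<beta>)
      + 2 / D * (\<Sum>\<alpha>\<in>{0..<3::int}. \<Sum>\<beta>\<in>{0..<3::int}. real_of_int (K \<alpha> \<beta>)) + 9 * (2 * m / D + 8)"
    by (simp add: sum.distrib sum_distrib_left)
  also have "\<dots> \<le> 1 / (m * D) * (h * (4 / 5 * k + 4)) + (1 / D + 4 / m) * (3 * h) + 2 / D * (3 * k) + 9 * (2 * m / D + 8)"
    using sumlK suml3 sumK rk D by (intro add_mono mult_left_mono) auto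
  also have "\<dots> = (D + 1) / D * (4 / 5 * k + 4) + 3 * m * ((D + 1) / D) + 12 * q + 6 * (k / D) + 18 * (m / D) + 72"
    using rk D unfolding h_def of_int_mult D(2) by (simp add: field_simps)
  also have "\<dots> \<le> 1000 / 999 * (4 / 5 * k + 4) + 3 * m * (1000 / 999) + 12 * q + 6 * (k / 999) + 18 * (m / 999) + 72"
  proof -
    have "(D + 1) / D \<le> 1000 / 999" using D by (simp add: field_simps)
    moreover have "k / D \<le> k / 999"
      by (rule divide_left_mono) (use D rk in linarith, use D rk in linarith, use D in simp)
    moreover have "m / D \<le> m / 999"
      by (rule divide_left_mono) (use D rk in linarith, use D rk in linarith, use D in simp)
    ultimately show ?thesis using rk by (intro add_mono mult_left_mono mult_right_mono order.refl) auto
  qed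
  also have "\<dots> \<le> 9 / 10 * k" using rk unfolding of_int_add distrib_left by linarith
  finally show ?thesis using le1 unfolding K_def by linarith
qed

subsection \<open>Large k: the complement of a regular set\<close>

text \<open>The removed set: a \<open>d \<times> d\<close> square on the main diagonal, another one on the antidiagonal, and a
  cyclic pattern on the remaining \<open>n - 2 * d\<close> rows and columns, the columns being relabelled by
  \<open>0, \<dots>, n - 2 * d - 1\<close>.\<close>

definition dense_set :: "int \<Rightarrow> int \<Rightarrow> (int \<times> int) set" where
  "dense_set n d = {(x, y). x \<in> {0..<n} \<and> y \<in> {0..<n} \<and>
     \<not> (if x < d then y < d
        else if x < 2 * d then n - 2 * d \<le> y \<and> y < n - d
        else (y < n - 2 * d \<and> d \<le> y \<or> n - d \<le> y) \<and>
             ((if y < n - 2 * d then y else y - (n - d)) + x) mod (n - 2 * d) < d)}"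

lemma dense_set_bounds:
  assumes "(x, y) \<in> dense_set n d"
  shows "x \<in> {0..<n}" "y \<in> {0..<n}"
  using assms by (simp_all only: dense_set_def mem_Collect_eq prod.case)

lemma dense_set_subset: "dense_set n d \<subseteq> {0..<n} \<times> {0..<n}"
  using dense_set_bounds by (intro subrelI mem_Sigma_iff[THEN iffD2] conjI)

section \<open>Row and column counts of the dense set\<close>

lemma card_mod_window:
  fixes w c d :: int
  assumes "w > 0" "0 \<le> d" "d \<le> w"
  shows "card {i \<in> {0..<w}. (i + c) mod w < d} = nat d"
proof -
  have "bij_betw (\<lambda>i. (i + c) mod w) {i \<in> {0..<w}. (i + c) mod w < d} {0..<d}"
  proof (rule bij_betwI[where g = "\<lambda>s. (s - c) mod w"])
    show "(\<lambda>i. (i + c) mod w) \<in> {i \<in> {0..<w}. (i + c) mod w < d} \<rightarrow> {0..<d}"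
      using assms by auto
    show "(\<lambda>s. (s - c) mod w) \<in> {0..<d} \<rightarrow> {i \<in> {0..<w}. (i + c) mod w < d}"
      using assms by (auto simp: mod_simps)
  qed (use assms in \<open>auto simp: mod_simps\<close>)
  then show ?thesis by (simp add: bij_betw_same_card)
qed

text \<open>The removed points of a row are counted instead: an interval of \<open>d\<close> columns
  in the rows of the two squares, a residue window in the others.\<close>

lemma dense_set_row:
  fixes n d :: int
  assumes d: "0 \<le> d" "3 * d < n" and x: "x \<in> {0..<n}"
  shows "card {y. (x, y) \<in> dense_set n d} = nat (n - d)"
proof -
  define T where "T = {y \<in> {0..<n}. (x, y) \<notin> dense_set n d}"
  have "card T = nat d"
  proof -
    consider "x < d" | "d \<le> x" "x < 2 * d" | "2 * d \<le> x" by linarith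
    then show ?thesis
    proof cases
      case 1
      then have "T = {0..<d}" using d x by (auto simp: T_def dense_set_def)
      then show ?thesis by simp
    next
      case 2
      then have "T = {n - 2 * d..<n - d}" using d x by (auto simp: T_def dense_set_def)
      then show ?thesis by simp
    next
      case 3
      \<comment> \<open>\<open>?f\<close> undoes the relabelling of the columns: labels below
        \<open>d\<close> belong to the last \<open>d\<close> columns, the other labels are the
        columns themselves.\<close>
      let ?f = "\<lambda>i. if i < d then i + (n - d) else i"
      have "T = ?f ` {i \<in> {0..<n - 2 * d}. (i + x) mod (n - 2 * d) < d}"
      proof (intro equalityI subsetI)
        fix y assume y: "y \<in> T"
        let ?i = "if y < n - 2 * d then y else y - (n - d)"
        have "y = ?f ?i" "?i \<in> {i \<in> {0..<n - 2 * d}. (i + x) mod (n - 2 * d) < d}"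
          using y 3 d x by (auto simp: T_def dense_set_def split: if_splits)
        then show "y \<in> ?f ` {i \<in> {0..<n - 2 * d}. (i + x) mod (n - 2 * d) < d}" by (rule image_eqI)
      next
        fix y assume "y \<in> ?f ` {i \<in> {0..<n - 2 * d}. (i + x) mod (n - 2 * d) < d}"
        then show "y \<in> T" using 3 d x by (auto simp: T_def dense_set_def split: if_splits)
      qed
      moreover have "inj_on ?f {i \<in> {0..<n - 2 * d}. (i + x) mod (n - 2 * d) < d}"
        using d by (auto simp: inj_on_def split: if_splits)
      ultimately have "card T = card {i \<in> {0..<n - 2 * d}. (i + x) mod (n - 2 * d) < d}"
        by (simp only: card_image)
      then show ?thesis using card_mod_window[of "n - 2 * d" d x] d by simp
    qed
  qed
  moreover have "{y. (x, y) \<in> dense_set n d} = {0..<n} - T"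
    unfolding T_def using dense_set_bounds(2) by blast
  moreover have "T \<subseteq> {0..<n}" by (auto simp: T_def)
  ultimately have "card {y. (x, y) \<in> dense_set n d} = nat n - nat d"
    by (simp add: card_Diff_subset finite_subset)
  then show ?thesis using d by simp
qed

lemma dense_set_column:
  fixes n d :: int
  assumes d: "0 \<le> d" "3 * d < n" and y: "y \<in> {0..<n}"
  shows "card {x. (x, y) \<in> dense_set n d} = nat (n - d)"
proof -
  define T where "T = {x \<in> {0..<n}. (x, y) \<notin> dense_set n d}"
  have "card T = nat d"
  proof -
    consider "y < d" | "n - 2 * d \<le> y" "y < n - d" | "d \<le> y" "y < n - 2 * d" | "n - d \<le> y" by linarith
    then show ?thesis
    proof cases
      case 1
      then have "T = {0..<d}" using d y by (auto simp: T_def dense_set_def split: if_splits)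
      then show ?thesis by simp
    next
      case 2
      then have "T = {d..<2 * d}" using d y by (auto simp: T_def dense_set_def split: if_splits)
      then show ?thesis by simp
    next
      case 3
      \<comment> \<open>The rows from \<open>2 * d\<close> on make up exactly one period
        \<open>n - 2 * d\<close> of the cyclic pattern.\<close>
      have "T = (\<lambda>i. i + 2 * d) ` {i \<in> {0..<n - 2 * d}. (i + (y + 2 * d)) mod (n - 2 * d) < d}"
      proof (intro equalityI subsetI)
        fix x assume "x \<in> T"
        then show "x \<in> (\<lambda>i. i + 2 * d) ` {i \<in> {0..<n - 2 * d}. (i + (y + 2 * d)) mod (n - 2 * d) < d}"
          using 3 d y by (intro image_eqI[of _ _ "x - 2 * d"])
            (auto simp: T_def dense_set_def algebra_simps split: if_splits)
      qed (use 3 d y in \<open>auto simp: T_def dense_set_def algebra_simps split: if_splits\<close>)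
      then have "card T = card {i \<in> {0..<n - 2 * d}. (i + (y + 2 * d)) mod (n - 2 * d) < d}"
        by (simp only: card_image inj_on_def) (simp add: card_image inj_on_def)
      then show ?thesis using card_mod_window[of "n - 2 * d" d "y + 2 * d"] d by simp
    next
      case 4
      have "T = (\<lambda>i. i + 2 * d) ` {i \<in> {0..<n - 2 * d}. (i + (y - (n - d) + 2 * d)) mod (n - 2 * d) < d}"
      proof (intro equalityI subsetI)
        fix x assume "x \<in> T"
        then show "x \<in> (\<lambda>i. i + 2 * d) ` {i \<in> {0..<n - 2 * d}. (i + (y - (n - d) + 2 * d)) mod (n - 2 * d) < d}"
          using 4 d y by (intro image_eqI[of _ _ "x - 2 * d"])
            (auto simp: T_def dense_set_def algebra_simps split: if_splits)
      qed (use 4 d y in \<open>auto simp: T_def dense_set_def algebra_simps split: if_splits\<close>)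
      then have "card T = card {i \<in> {0..<n - 2 * d}. (i + (y - (n - d) + 2 * d)) mod (n - 2 * d) < d}"
        by (simp only: card_image inj_on_def) (simp add: card_image inj_on_def)
      then show ?thesis using card_mod_window[of "n - 2 * d" d "y - (n - d) + 2 * d"] d by simp
    qed
  qed
  moreover have "{x. (x, y) \<in> dense_set n d} = {0..<n} - T"
    unfolding T_def using dense_set_bounds(1) by blast
  moreover have "T \<subseteq> {0..<n}" by (auto simp: T_def)
  ultimately have "card {x. (x, y) \<in> dense_set n d} = nat n - nat d"
    by (simp add: card_Diff_subset finite_subset)
  then show ?thesis using d by simp
qed

section \<open>Lines through the dense set\<close>

lemma card_le_of_inj_interval:
  fixes f :: "int \<Rightarrow> int"
  assumes "inj_on f H" "f ` H \<subseteq> {a..<b}" "a \<le> b"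
  shows "int (card H) \<le> b - a"
proof -
  have "card H = card (f ` H)" using card_image[OF assms(1)] by simp
  also have "\<dots> \<le> card {a..<b}" using assms(2) by (intro card_mono) auto
  finally show ?thesis using assms(3) by simp
qed

lemma card_int_span:
  fixes H :: "int set"
  assumes fin: "finite H" and w: "w > 0" and N: "N \<ge> 0"
    and span: "\<And>s t. s \<in> H \<Longrightarrow> t \<in> H \<Longrightarrow> (t - s) * w \<le> N"
  shows "int (card H) * w \<le> N + w"
proof (cases "H = {}")
  case True
  then show ?thesis using w N by simp
next
  case False
  have "H \<subseteq> {Min H..Max H}" using fin False by auto
  then have "card H \<le> card {Min H..Max H}" by (intro card_mono) auto
  moreover have "Min H \<le> Max H" using fin False by simp
  ultimately have "int (card H) \<le> Max H - Min H + 1" by simp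
  then have "int (card H) * w \<le> (Max H - Min H + 1) * w" using w by (intro mult_right_mono) auto
  also have "\<dots> \<le> N + w" using span[OF Min_in[OF fin False] Max_in[OF fin False]] by (simp add: algebra_simps)
  finally show ?thesis .
qed

text \<open>A step of at least 2 in one coordinate leaves at most \<open>(n + 1) / 2\<close> points,
  and \<open>3 * d < n\<close> makes this at most \<open>n - d\<close>. Slope 1 is settled by the
  removed square at the origin; an antidiagonal longer than \<open>n - d\<close> loses its excess in
  the other square.\<close>

lemma dense_set_line:
  fixes n d x0 y0 u v :: int
  assumes d: "0 \<le> d" "3 * d < n" and u: "u > 0" and v: "v \<noteq> 0"
  shows "int (card {t. (x0 + t * u, y0 + t * v) \<in> dense_set n d}) \<le> n - d"
proof -
  define H where "H = {t. (x0 + t * u, y0 + t * v) \<in> dense_set n d}"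
  have "finite (dense_set n d)" by (rule finite_subset[OF dense_set_subset]) simp
  then have fin: "finite H" unfolding H_def using u by (intro finite_line_params) auto
  have box: "0 \<le> x0 + t * u" "x0 + t * u < n" "0 \<le> y0 + t * v" "y0 + t * v < n" if "t \<in> H" for t
    using dense_set_bounds[of "x0 + t * u" "y0 + t * v" n d] that by (simp_all add: H_def)
  have not1: "\<not> (x0 + t * u < d \<and> y0 + t * v < d)" if "t \<in> H" for t
    using that by (auto simp: H_def dense_set_def)
  have not2: "\<not> (d \<le> x0 + t * u \<and> x0 + t * u < 2 * d \<and> n - 2 * d \<le> y0 + t * v \<and> y0 + t * v < n - d)"
    if "t \<in> H" for t
    using that d by (auto simp: H_def dense_set_def split: if_splits)
  have wide: "int (card H) \<le> n - d" if w: "w \<ge> 2" and span: "\<And>s t. s \<in> H \<Longrightarrow> t \<in> H \<Longrightarrow> (t - s) * w \<le> n - 1" for w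
  proof -
    have "int (card H) * w \<le> (n - 1) + w" by (rule card_int_span[OF fin]) (use w span d in auto)
    then have "(int (card H) - 1) * w \<le> n - 1" by (simp add: algebra_simps)
    moreover have "(int (card H) - 1) * 2 \<le> (int (card H) - 1) * w \<or> int (card H) = 0"
      using w by (cases "card H") (auto intro: mult_left_mono)
    ultimately have "2 * int (card H) \<le> n + 1" using d by auto
    then show ?thesis using d by linarith
  qed
  consider "u \<ge> 2" | "v \<ge> 2" | "v \<le> -2" | "u = 1" "v = 1" | "u = 1" "v = -1" using u v by linarith
  then have "int (card H) \<le> n - d"
  proof cases
    case 1
    show ?thesis
    proof (rule wide[OF 1])
      fix s t assume "s \<in> H" "t \<in> H"
      then show "(t - s) * u \<le> n - 1" using box(1)[of s] box(2)[of t] by (simp add: algebra_simps)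
    qed
  next
    case 2
    show ?thesis
    proof (rule wide[OF 2])
      fix s t assume "s \<in> H" "t \<in> H"
      then show "(t - s) * v \<le> n - 1" using box(3)[of s] box(4)[of t] by (simp add: algebra_simps)
    qed
  next
    case 3
    show ?thesis
    proof (rule wide[of "-v"])
      fix s t assume "s \<in> H" "t \<in> H"
      then show "(t - s) * (-v) \<le> n - 1" using box(3)[of t] box(4)[of s] by (simp add: algebra_simps)
    qed (use 3 in simp)
  next
    case 4
    have "int (card H) \<le> n - d"
    proof (rule card_le_of_inj_interval)
      \<comment> \<open>\<open>t + max x0 y0\<close> is the larger coordinate, which is at least
        \<open>d\<close> outside the square at the origin.\<close>
      show "inj_on (\<lambda>t. t + max x0 y0) H" by (auto simp: inj_on_def)
      show "(\<lambda>t. t + max x0 y0) ` H \<subseteq> {d..<n}"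
      proof
        fix z assume "z \<in> (\<lambda>t. t + max x0 y0) ` H"
        then obtain t where t: "t \<in> H" "z = t + max x0 y0" by auto
        show "z \<in> {d..<n}" using not1[OF t(1)] box[OF t(1)] t(2) 4 by (auto simp: max_def)
      qed
    qed (use d in simp)
    then show ?thesis .
  next
    case 5
    \<comment> \<open>The antidiagonal with coordinate sum \<open>s\<close> has \<open>s + 1\<close>
      grid points up to the main one and \<open>2 * n - 1 - s\<close> beyond it.\<close>
    define s where "s = x0 + y0"
    show ?thesis
    proof (cases "s \<le> n - 1")
      case True
      show ?thesis
      proof (cases "s + 1 \<le> n - d")
        case small: True
        show ?thesis
        proof (cases "H = {}")
          case False
          then obtain t where "t \<in> H" by auto
          then have "s \<ge> 0" using box[of t] 5 by (simp add: s_def)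
          then have "int (card H) \<le> (s + 1) - 0"
            using box 5 by (intro card_le_of_inj_interval[of "\<lambda>t. x0 + t"])
              (fastforce simp: inj_on_def s_def)+
          then show ?thesis using small by simp
        qed (use d in simp)
      next
        case False
        \<comment> \<open>\<open>e\<close> is the excess of the antidiagonal over
          \<open>n - d\<close>. Its points with first coordinate in \<open>[d, d + e)\<close> lie in
          the removed square, and \<open>?f\<close> closes this gap.\<close>
        define e where "e = s + 1 - (n - d)"
        have "int (card H) \<le> (s + 1 - e) - 0"
        proof (rule card_le_of_inj_interval)
          let ?f = "\<lambda>t. if x0 + t < d then x0 + t else x0 + t - e"
          have away: "x0 + t < d \<or> d + e \<le> x0 + t" if "t \<in> H" for t
            using not2[OF that] True False d 5 by (auto simp: e_def s_def)
          have e: "e > 0" using False by (simp add: e_def)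
          show "inj_on ?f H"
          proof (rule inj_onI)
            fix a b assume "a \<in> H" "b \<in> H" "?f a = ?f b"
            then show "a = b" using away[of a] away[of b] e by (auto split: if_splits)
          qed
          show "?f ` H \<subseteq> {0..<s + 1 - e}"
          proof
            fix z assume "z \<in> ?f ` H"
            then obtain t where t: "t \<in> H" "z = ?f t" by auto
            show "z \<in> {0..<s + 1 - e}"
              using away[OF t(1)] box[OF t(1)] t(2) e d 5 by (auto simp: s_def e_def split: if_splits)
          qed
        qed (use d in \<open>simp add: e_def\<close>)
        then show ?thesis by (simp add: e_def)
      qed
    next
      case big: False
      define l where "l = 2 * n - 1 - s"
      show ?thesis
      proof (cases "l \<le> n - d")
        case small: True
        show ?thesis
        proof (cases "H = {}")
          case False
          then obtain t where "t \<in> H" by auto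
          then have "l \<ge> 0" using box[of t] 5 by (simp add: s_def l_def)
          then have "int (card H) \<le> n - (n - l)"
            using box 5 by (intro card_le_of_inj_interval[of "\<lambda>t. x0 + t"])
              (fastforce simp: inj_on_def s_def l_def)+
          then show ?thesis using small by simp
        qed (use d in simp)
      next
        case False
        \<comment> \<open>Beyond the main antidiagonal the gap is
          \<open>[2 * d - e, 2 * d)\<close>.\<close>
        define e where "e = l - (n - d)"
        have "int (card H) \<le> (n - e) - (n - l)"
        proof (rule card_le_of_inj_interval)
          let ?f = "\<lambda>t. if x0 + t < 2 * d - e then x0 + t else x0 + t - e"
          have away: "x0 + t < 2 * d - e \<or> 2 * d \<le> x0 + t" if "t \<in> H" for t
            using not2[OF that] big False d 5 by (auto simp: e_def s_def l_def)
          have e: "e > 0" "e \<le> d" using False big by (auto simp: e_def l_def)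
          show "inj_on ?f H"
          proof (rule inj_onI)
            fix a b assume "a \<in> H" "b \<in> H" "?f a = ?f b"
            then show "a = b" using away[of a] away[of b] e by (auto split: if_splits)
          qed
          show "?f ` H \<subseteq> {n - l..<n - e}"
          proof
            fix z assume "z \<in> ?f ` H"
            then obtain t where t: "t \<in> H" "z = ?f t" by auto
            show "z \<in> {n - l..<n - e}"
              using away[OF t(1)] box[OF t(1)] t(2) e d 5 by (auto simp: s_def e_def l_def split: if_splits)
          qed
        qed (use d False big in \<open>simp add: e_def\<close>)
        then show ?thesis by (simp add: e_def)
      qed
    qed
  qed
  then show ?thesis by (simp add: H_def)
qed

lemma regular_spread_dense_set:
  assumes "2 * n < 3 * k" "k \<le> n"
  shows "regular_spread n k k (dense_set (int n) (int n - int k))"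
proof -
  have d: "0 \<le> int n - int k" "3 * (int n - int k) < int n" using assms by auto
  have "card {t. (x0 + t * u, y0 + t * v) \<in> dense_set (int n) (int n - int k)} \<le> k"
    if "u > 0" "v \<noteq> 0" for x0 y0 u v
    using dense_set_line[OF d that, of x0 y0] by simp
  then show ?thesis using dense_set_row[OF d] dense_set_column[OF d] dense_set_subset
    by (simp add: regular_spread_def)
qed

subsection \<open>Assembling the cases\<close>

text \<open>The tenth of \<open>k\<close> left free on every line of nonzero finite slope pays for
  the rows and columns added afterwards.\<close>

lemma regular_spread_block_set:
  fixes q m k :: nat
  assumes q: "q \<ge> 1000" and m: "0 < m" "m \<le> q" and k: "1000 * q \<le> k" and small: "2 * k + 9 \<le> 5 * (q * m)"
  shows "\<exists>S. regular_spread (3 * (q * m)) k (9 * k div 10) S"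
proof -
  \<comment> \<open>Rounding \<open>3 * k / 10\<close> down determines \<open>b\<close> and
    \<open>e\<close> through the row sums. It gives \<open>5 * b \<le> 2 * k + 9\<close>, so
    \<open>2 * k + 9 \<le> 5 * h\<close> yields \<open>b \<le> h\<close>.\<close>
  define a :: int where "a = 3 * int k div 10"
  define b where "b = int k - 2 * a"
  define e where "e = 4 * a - int k"
  define h where "h = int q * int m"
  have a: "10 * a \<le> 3 * int k" "3 * int k \<le> 10 * a + 9" unfolding a_def by linarith+
  have "int (2 * k + 9) \<le> int (5 * (q * m))" using small by (simp only: of_nat_le_iff)
  then have smallh: "2 * int k + 9 \<le> 5 * h" by (simp add: h_def)
  have kk: "int k \<ge> 1000000" using q k by linarith
  have abe: "0 \<le> a" "a \<le> b" "0 \<le> e" "e \<le> b" "b \<le> h" "5 * b \<le> 2 * int k + 10"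
    and sum: "2 * a + b = int k" "2 * b + e = int k"
    and M: "5 * (2 * a + e) \<le> 4 * int k + 20" "5 * (2 * b) \<le> 4 * int k + 20"
    using a smallh kk by (simp_all add: b_def e_def)
  define K where "K = block_density a b e"
  have K: "0 \<le> K \<alpha> \<beta> \<and> K \<alpha> \<beta> \<le> b" for \<alpha> \<beta>
    using abe by (auto simp: K_def block_density_def)
  have Kh: "0 \<le> K \<alpha> \<beta> \<and> K \<alpha> \<beta> \<le> int q * int m" for \<alpha> \<beta>
    using K[of \<alpha> \<beta>] abe unfolding h_def by linarith
  have Ksum: "(\<Sum>\<beta>\<in>{0..<3}. nat (K \<alpha> \<beta>)) = k" "(\<Sum>\<beta>\<in>{0..<3}. nat (K \<beta> \<alpha>)) = k" if "0 \<le> \<alpha>" "\<alpha> < 3" for \<alpha>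
  proof -
    have "{0..<3::int} = {0, 1, 2}" by auto
    moreover have "\<alpha> = 0 \<or> \<alpha> = 1 \<or> \<alpha> = 2" using that by auto
    ultimately have "(\<Sum>\<beta>\<in>{0..<3}. K \<alpha> \<beta>) = k" "(\<Sum>\<beta>\<in>{0..<3}. K \<beta> \<alpha>) = k"
      using sum by (auto simp: K_def block_density_def)
    moreover have "int (\<Sum>\<beta>\<in>{0..<3}. nat (K \<alpha> \<beta>)) = (\<Sum>\<beta>\<in>{0..<3}. K \<alpha> \<beta>)"
      "int (\<Sum>\<beta>\<in>{0..<3}. nat (K \<beta> \<alpha>)) = (\<Sum>\<beta>\<in>{0..<3}. K \<beta> \<alpha>)"
      using K by simp_all
    ultimately show "(\<Sum>\<beta>\<in>{0..<3}. nat (K \<alpha> \<beta>)) = k" "(\<Sum>\<beta>\<in>{0..<3}. nat (K \<beta> \<alpha>)) = k"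
      by linarith+
  qed
  let ?S = "block_set (int q) (int m) K"
  have pos: "int q > 0" "int m > 0" "int q * int m > 0" using q m by auto
  have divs: "0 \<le> z div (int q * int m)" "z div (int q * int m) < 3" if "z \<in> {0..<3 * (int q * int m)}" for z
    using that pos by (auto simp: pos_imp_zdiv_nonneg_iff intro!: int_div_less)
  have row: "card {y. (x, y) \<in> ?S} = k" if "x \<in> {0..<3 * (int q * int m)}" for x
    using block_set_row[OF pos(1,2) Kh that] Ksum(1) divs[OF that] by simp
  have col: "card {x. (x, y) \<in> ?S} = k" if "y \<in> {0..<3 * (int q * int m)}" for y
    using block_set_column[OF pos(1,2) Kh that] Ksum(2) divs[OF that] by simp
  have line: "card {t. (x0 + t * u, y0 + t * v) \<in> ?S} \<le> 9 * k div 10" if uv: "u > 0" "v \<noteq> 0" for x0 y0 u v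
  proof -
    have "real (card {t. (x0 + t * u, y0 + t * v) \<in> ?S}) \<le> 9 / 10 * real_of_int (int k)"
    proof (cases "u \<ge> 2 \<or> \<bar>v\<bar> \<ge> 2")
      case True
      show ?thesis
        by (rule block_set_steep_line[of _ _ _ b]) (use q m k abe K uv True in \<open>auto simp: h_def\<close>)
    next
      case False
      then have "u = 1" "v = 1 \<or> v = -1" using uv by auto
      have "real (card {t. (x0 + t * 1, y0 + t * v) \<in> ?S}) \<le> 9 / 10 * real_of_int (int k)"
        unfolding K_def
      proof (rule block_set_diagonal)
        show "v = 1 \<or> v = -1" by fact
      qed (use q m k abe sum M in \<open>auto simp: h_def\<close>)
      then show ?thesis using \<open>u = 1\<close> by simp
    qed
    then have "10 * real (card {t. (x0 + t * u, y0 + t * v) \<in> ?S}) \<le> 9 * real k" by simp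
    then have "10 * card {t. (x0 + t * u, y0 + t * v) \<in> ?S} \<le> 9 * k" by linarith
    then show ?thesis by linarith
  qed
  have sub: "?S \<subseteq> {0..<3 * (int q * int m)} \<times> {0..<3 * (int q * int m)}" by (auto simp: block_set_def)
  have "int (3 * (q * m)) = 3 * (int q * int m)" by simp
  then have "regular_spread (3 * (q * m)) k (9 * k div 10) ?S"
    unfolding regular_spread_def using sub row col line by simp
  then show ?thesis ..
qed

text \<open>With \<open>q\<close> the integer part of \<open>sqrt n\<close> and
  \<open>m = n div (3 * q)\<close>, the blocks leave out \<open>r < 3 * q\<close> rows and columns.
  Adding these raises the line bound by \<open>2 * r < 6 * q\<close>, less than the free tenth of
  \<open>k\<close>.\<close>

lemma ex_regular_spread:
  fixes n k :: nat
  assumes n: "n \<ge> 1000000" and k: "real k \<ge> 1000 * sqrt n" "3 * k \<le> 2 * n"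
  shows "\<exists>S. regular_spread n k k S"
proof -
  define q where "q = nat \<lfloor>sqrt n\<rfloor>"
  have sq0: "sqrt n \<ge> 0" by simp
  have q_le: "real q \<le> sqrt n" and q_gt: "sqrt n < real q + 1"
    unfolding q_def using sq0 by linarith+
  have "real q ^ 2 \<le> sqrt n ^ 2" using q_le by (intro power_mono) auto
  then have "real (q ^ 2) \<le> real n" by simp
  then have qn: "q * q \<le> n" by (simp only: of_nat_le_iff power2_eq_square)
  have "sqrt n ^ 2 < (real q + 1) ^ 2" using q_gt by (intro power_strict_mono) auto
  then have "real n < real ((q + 1) ^ 2)" by (simp add: algebra_simps)
  then have nq: "n < (q + 1) * (q + 1)" by (simp only: of_nat_less_iff power2_eq_square)
  have "sqrt 1000000 \<le> sqrt n" using n by (intro real_sqrt_le_mono) simp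
  moreover have "sqrt 1000000 = 1000" using real_sqrt_unique[of 1000 1000000] by simp
  ultimately have "1000 < real q + 1" using q_gt by linarith
  then have q1000: "q \<ge> 1000" by linarith
  have "1000 * real q \<le> real k" using q_le k(1) by linarith
  then have kq: "1000 * q \<le> k" by linarith
  define m where "m = n div (3 * q)"
  define r where "r = n mod (3 * q)"
  have nr: "n = 3 * (q * m) + r" unfolding m_def r_def by (metis mult.assoc mult_div_mod_eq)
  have r: "r < 3 * q" unfolding r_def using q1000 by simp
  have q1: "1000 * q \<le> q * q" using q1000 by simp
  have m0: "m > 0"
  proof (rule ccontr)
    assume "\<not> m > 0"
    then have "n < 3 * q" using nr r by simp
    then show False using qn q1 by linarith
  qed
  \<comment> \<open>If \<open>m > q\<close> then \<open>n \<ge> 3 * q * (q + 1)\<close>,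
    contradicting \<open>n < (q + 1) * (q + 1)\<close>.\<close>
  have mq: "m \<le> q"
  proof (rule ccontr)
    assume "\<not> m \<le> q"
    then have "q * (q + 1) \<le> q * m" by (intro mult_left_mono) auto
    then have "3 * (q * q) + 3 * q \<le> n" using nr by (simp add: algebra_simps)
    moreover have "n < q * q + 2 * q + 1" using nq by (simp add: algebra_simps)
    ultimately show False using q1000 by linarith
  qed
  \<comment> \<open>\<open>3 * (q * m)\<close> misses \<open>n\<close> by less than
    \<open>3 * q\<close>, so \<open>5 * (q * m)\<close> is about \<open>5 * n / 3\<close>, whereas
    \<open>2 * k \<le> 4 * n / 3\<close>.\<close>
  have small: "2 * k + 9 \<le> 5 * (q * m)" using k(2) nr r qn q1 q1000 by linarith
  obtain S where S: "regular_spread (3 * (q * m)) k (9 * k div 10) S"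
    using regular_spread_block_set[OF q1000 m0 mq kq small] ..
  have "k \<le> 3 * (q * m)" using small by linarith
  from regular_spread_add[OF S this, of r]
  obtain S' where "regular_spread n k (9 * k div 10 + 2 * r) S'"
    unfolding nr[symmetric] ..
  moreover have "9 * k div 10 + 2 * r \<le> k" using r kq by linarith
  ultimately have "regular_spread n k k S'" by (rule regular_spread_mono)
  then show ?thesis ..
qed

text \<open>For \<open>n \<ge> 1\<close> the grid has only \<open>n * n\<close> points, so the
  identity forces \<open>k \<le> n\<close>; the formal statement makes this range explicit.\<close>

theorem theorem1p1:
  fixes C :: real
  assumes "C > 5 / 2 * sqrt 35"
  shows "\<exists>N :: nat. \<forall>n k :: nat. n \<ge> N \<and> real k \<ge> C * sqrt (real n * ln (real n)) \<and> k \<le> n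
           \<longrightarrow> max_points k n = k * n"
proof (intro exI allI impI)
  fix n k :: nat
  \<comment> \<open>The threshold makes \<open>sqrt (ln n) \<ge> 1000\<close>, which together with
    \<open>C \<ge> 1\<close> turns the assumption on \<open>k\<close> into
    \<open>k \<ge> 1000 * sqrt n\<close>.\<close>
  assume *: "n \<ge> nat \<lceil>exp (1000000 :: real)\<rceil> \<and> real k \<ge> C * sqrt (real n * ln (real n)) \<and> k \<le> n"
  have "1 \<le> sqrt 35" by simp
  then have C: "C \<ge> 1" using assms by linarith
  have exp: "exp 1000000 \<le> real n" using * by linarith
  have "1 + 1000000 \<le> exp (1000000 :: real)" by (rule exp_ge_add_one_self)
  then have n: "n \<ge> 1000000" using exp by linarith
  have "1000000 \<le> ln (real n)" using exp n by (subst ln_ge_iff) auto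
  then have "sqrt 1000000 \<le> sqrt (ln (real n))" by (rule real_sqrt_le_mono)
  moreover have "sqrt 1000000 = 1000" using real_sqrt_unique[of 1000 1000000] by simp
  ultimately have "sqrt n * 1000 \<le> sqrt n * sqrt (ln n)" by (intro mult_left_mono) auto
  also have "\<dots> = sqrt (real n * ln n)" by (simp add: real_sqrt_mult)
  also have "1 * \<dots> \<le> C * sqrt (real n * ln n)" using C n by (intro mult_right_mono) auto
  also have "\<dots> \<le> real k" using * by simp
  finally have k: "real k \<ge> 1000 * sqrt n" by simp
  have "sqrt n \<ge> 1" using n by simp
  then have k1: "k \<ge> 1" using k by linarith
  show "max_points k n = k * n"
  proof (cases "3 * k \<le> 2 * n")
    case True
    obtain S where "regular_spread n k k S" using ex_regular_spread[OF n k True] ..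
    then show ?thesis using k1 by (rule max_points_eq_of_regular_spread)
  next
    case False
    then show ?thesis
      using max_points_eq_of_regular_spread[OF regular_spread_dense_set k1] * by simp
  qed
qed

end
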